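(* Let $\delta\in(0,1)$, $0<\gamma<1$, $\alpha,\beta>0$, and let $m,n,l,K\ge1$ be integers. Let $s_1,\dots,s_m$ be states sampled i.i.d. according to the probability distribution $d$, and for each state $s_i$ let $n$ independent rollouts truncated at length $l$ be sampled, with $\bar v(s_i)$ the average of the $n$ truncated returns and $\bar\sigma_i$ their (empirical) standard deviation. Let $\hat v$ range over $K$ value functions $\mathcal S\to\mathbb R$ for each of which the loss $|\hat v(S)-v^*(S)|$, $S\sim d$, is a sub-exponential random variable with parameters $\alpha$ and $\beta$. Let $$\sigma_1=\alpha\sqrt{\frac{2\log(4K/\delta)}{m}},\qquad \sigma_2=\frac{2\log(4K/\delta)}{\beta m}.$$ Set $t=\sigma_1$ if $0<\sigma_1\le\alpha^2\beta$ and $0<\sigma_2\le\alpha^2\beta$, and $t=\sigma_2$ if $\sigma_1>\alpha^2\beta$ and $\sigma_2>\alpha^2\beta$. Then with probability at least $1-\delta$, for all these $\hat v$, $$\left|\ell(\hat v,v^* )-\hat\ell(\hat v,\bar v)\right|\le t+\zeta,$$ where $$\zeta=3R_{\max}\left(\frac{1-\gamma^{l}}{1-\gamma}\right)\frac{\log(6m/\delta)}{n}+\frac{\sum_{i=1}^m\bar\sigma_i}{m}\sqrt{\frac{2\log(6m/\delta)}{n}}+R_{\max}\frac{\gamma^{l}}{1-\gamma}.$$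
   Context: Setting: a Markov decision process with state space $\mathcal S$, rewards bounded in absolute value by $R_{\max}$, constant discount $\gamma$, and a fixed policy $\pi$. $v^*(s)=\mathbb E\left[\sum_{k=0}^\infty\gamma^kR_k\right]$ is the expected discounted return from $s$ under $\pi$. A rollout from $s_i$ truncated at length $l$ gives the truncated return $g_{ij}=\sum_{k=0}^{l-1}\gamma^kr_{ijk}$, $j=1,\dots,n$; $\bar v(s_i)=\frac1n\sum_{j=1}^n g_{ij}$ and $\bar\sigma_i=\sqrt{\frac1n\sum_{j=1}^n(g_{ij}-\bar v(s_i))^2}$. Loss (unclipped mean absolute value error): $\ell(\hat v,v)=\mathbb E_{S\sim d}\left[|\hat v(S)-v(S)|\right]$ and $\hat\ell(\hat v,v)=\frac1m\sum_{i=1}^m|\hat v(s_i)-v(s_i)|$. A random variable $X$ with mean $\mu$ is sub-exponential with parameters $\alpha,\beta$ if $\mathbb E[e^{\lambda(X-\mu)}]\le e^{\alpha^2\lambda^2/2}$ for all $|\lambda|\le\beta$. *)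

theory Defs
  imports "HOL-Probability.Probability"
begin

text \<open>
  Markov decision processes on arbitrary measurable state and action spaces.
  \<open>T (s, a)\<close> is the joint law of the immediate reward and the next state, so rewards may be
  random and may depend on the next state.
\<close>

locale mdp =
  fixes S :: "'s measure" and A :: "'a measure"
    and T :: "'s \<times> 'a \<Rightarrow> (real \<times> 's) measure"
    and R_max :: real
  assumes kernel: "T \<in> S \<Otimes>\<^sub>M A \<rightarrow>\<^sub>M prob_algebra (borel \<Otimes>\<^sub>M S)"
    and reward_bounded:
      "\<And>s a. s \<in> space S \<Longrightarrow> a \<in> space A \<Longrightarrow> AE (r, s') in T (s, a). \<bar>r\<bar> \<le> R_max"

text \<open>
  One step from state \<open>s\<close> under the policy \<open>\<pi>\<close>: the law of (action, reward, next state).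
\<close>

definition step_space :: "'s measure \<Rightarrow> 'a measure \<Rightarrow> ('a \<times> real \<times> 's) measure" where
  "step_space S A = A \<Otimes>\<^sub>M (borel \<Otimes>\<^sub>M S)"

definition step_law ::
  "'s measure \<Rightarrow> 'a measure \<Rightarrow> ('s \<times> 'a \<Rightarrow> (real \<times> 's) measure) \<Rightarrow> ('s \<Rightarrow> 'a measure) \<Rightarrow> 's
    \<Rightarrow> ('a \<times> real \<times> 's) measure" where
  "step_law S A T \<pi> s = \<pi> s \<bind> (\<lambda>a. distr (T (s, a)) (step_space S A) (\<lambda>x. (a, x)))"

text \<open>
  A trajectory is the sequence of steps \<open>(A\<^sub>0, R\<^sub>0, S\<^sub>1), (A\<^sub>1, R\<^sub>1, S\<^sub>2), \<dots>\<close>; its initial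
  state is a parameter of its law and not recorded in it.
\<close>

type_synonym ('s, 'a) traj = "nat \<Rightarrow> 'a \<times> real \<times> 's"

definition traj_space :: "'s measure \<Rightarrow> 'a measure \<Rightarrow> ('s, 'a) traj measure" where
  "traj_space S A = PiM UNIV (\<lambda>_. step_space S A)"

definition state_at :: "'s \<Rightarrow> ('s, 'a) traj \<Rightarrow> nat \<Rightarrow> 's" where
  "state_at s \<omega> k = (case k of 0 \<Rightarrow> s | Suc j \<Rightarrow> snd (snd (\<omega> j)))"

definition reward_at :: "('s, 'a) traj \<Rightarrow> nat \<Rightarrow> real" where
  "reward_at \<omega> k = fst (snd (\<omega> k))"

definition traj_kernel ::
  "'s measure \<Rightarrow> 'a measure \<Rightarrow> ('s \<times> 'a \<Rightarrow> (real \<times> 's) measure) \<Rightarrow> ('s \<Rightarrow> 'a measure) \<Rightarrow> 's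
    \<Rightarrow> nat \<Rightarrow> ('s, 'a) traj \<Rightarrow> ('a \<times> real \<times> 's) measure" where
  "traj_kernel S A T \<pi> s k \<omega> = step_law S A T \<pi> (state_at s \<omega> k)"

text \<open>
  The law of the trajectory from \<open>s\<close> under \<open>\<pi>\<close> is the Ionescu-Tulcea measure of these kernels
  (the constant called \<open>PF.lim\<close> inside the locale \<^locale>\<open>Ionescu_Tulcea\<close>; see
  \<open>Ionescu_Tulcea_traj\<close> below).
\<close>

definition traj_law ::
  "'s measure \<Rightarrow> 'a measure \<Rightarrow> ('s \<times> 'a \<Rightarrow> (real \<times> 's) measure) \<Rightarrow> ('s \<Rightarrow> 'a measure) \<Rightarrow> 's
    \<Rightarrow> ('s, 'a) traj measure" where
  "traj_law S A T \<pi> s =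
     projective_family.lim UNIV
       (Ionescu_Tulcea.CI (traj_kernel S A T \<pi> s) (\<lambda>_. step_space S A))
       (\<lambda>_. step_space S A)"

definition policy_value ::
  "'s measure \<Rightarrow> 'a measure \<Rightarrow> ('s \<times> 'a \<Rightarrow> (real \<times> 's) measure) \<Rightarrow> ('s \<Rightarrow> 'a measure) \<Rightarrow> real
    \<Rightarrow> 's \<Rightarrow> real" where
  "policy_value S A T \<pi> \<gamma> s = (\<integral>\<omega>. (\<Sum>k. \<gamma> ^ k * reward_at \<omega> k) \<partial>traj_law S A T \<pi> s)"

definition truncated_return :: "real \<Rightarrow> nat \<Rightarrow> ('s, 'a) traj \<Rightarrow> real" where
  "truncated_return \<gamma> l \<omega> = (\<Sum>k<l. \<gamma> ^ k * reward_at \<omega> k)"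

text \<open>
  The sample \<open>(s, \<tau>)\<close>: states \<open>s i\<close> (\<open>i < m\<close>) drawn i.i.d. from \<open>d\<close> and, given the states,
  independent trajectories \<open>\<tau> (i, j)\<close> (\<open>i < m\<close>, \<open>j < n\<close>), the one at \<open>(i, j)\<close> started in \<open>s i\<close>.
\<close>

definition sample_law ::
  "'s measure \<Rightarrow> 'a measure \<Rightarrow> ('s \<times> 'a \<Rightarrow> (real \<times> 's) measure) \<Rightarrow> ('s \<Rightarrow> 'a measure)
    \<Rightarrow> 's measure \<Rightarrow> nat \<Rightarrow> nat \<Rightarrow> ((nat \<Rightarrow> 's) \<times> (nat \<times> nat \<Rightarrow> ('s, 'a) traj)) measure" where
  "sample_law S A T \<pi> d m n =
     PiM {..<m} (\<lambda>_. d) \<bind> (\<lambda>s.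
       distr (PiM ({..<m} \<times> {..<n}) (\<lambda>(i, j). traj_law S A T \<pi> (s i)))
         (PiM {..<m} (\<lambda>_. S) \<Otimes>\<^sub>M PiM ({..<m} \<times> {..<n}) (\<lambda>_. traj_space S A))
         (\<lambda>\<tau>. (s, \<tau>)))"

definition sample_mean :: "nat \<Rightarrow> (nat \<Rightarrow> real) \<Rightarrow> real" where
  "sample_mean n g = (\<Sum>j<n. g j) / real n"

definition sample_sd :: "nat \<Rightarrow> (nat \<Rightarrow> real) \<Rightarrow> real" where
  "sample_sd n g = sqrt ((\<Sum>j<n. (g j - sample_mean n g)\<^sup>2) / real n)"

definition loss :: "'s measure \<Rightarrow> ('s \<Rightarrow> real) \<Rightarrow> ('s \<Rightarrow> real) \<Rightarrow> real" where
  "loss d u v = (\<integral>s. \<bar>u s - v s\<bar> \<partial>d)"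

text \<open>
  The targets \<open>y\<close> are indexed by the sample position rather than by the state: if the same
  state is drawn twice, the two positions have separate rollouts.
\<close>

definition empirical_loss :: "nat \<Rightarrow> (nat \<Rightarrow> 's) \<Rightarrow> ('s \<Rightarrow> real) \<Rightarrow> (nat \<Rightarrow> real) \<Rightarrow> real" where
  "empirical_loss m s u y = (\<Sum>i<m. \<bar>u (s i) - y i\<bar>) / real m"

text \<open>
  Integrability is explicit because the Bochner integral of a non-integrable function is \<open>0\<close>.
\<close>

definition sub_exponential :: "'b measure \<Rightarrow> ('b \<Rightarrow> real) \<Rightarrow> real \<Rightarrow> real \<Rightarrow> bool" where
  "sub_exponential M X \<alpha> \<beta> \<longleftrightarrow>
     integrable M X \<and>
     (\<forall>c. \<bar>c\<bar> \<le> \<beta> \<longrightarrow>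
        integrable M (\<lambda>x. exp (c * (X x - (\<integral>y. X y \<partial>M)))) \<and>
        (\<integral>x. exp (c * (X x - (\<integral>y. X y \<partial>M))) \<partial>M) \<le> exp (\<alpha>\<^sup>2 * c\<^sup>2 / 2))"

lemma (in mdp) step_law_measurable:
  assumes "\<pi> \<in> S \<rightarrow>\<^sub>M prob_algebra A"
  shows "step_law S A T \<pi> \<in> S \<rightarrow>\<^sub>M prob_algebra (step_space S A)"
proof -
  note assms[measurable] kernel[measurable]
  have [measurable]: "(\<lambda>x. distr (T x) (step_space S A) (\<lambda>y. (snd x, y)))
      \<in> S \<Otimes>\<^sub>M A \<rightarrow>\<^sub>M prob_algebra (step_space S A)"
    unfolding step_space_def
    by (rule measurable_distr_prob_space2[OF kernel]) measurable
  have "(\<lambda>s. \<pi> s \<bind> (\<lambda>a. distr (T (s, a)) (step_space S A) (\<lambda>x. (a, x))))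
      \<in> S \<rightarrow>\<^sub>M prob_algebra (step_space S A)"
  proof (rule measurable_bind_prob_space2[OF assms])
    show "(\<lambda>(s, a). distr (T (s, a)) (step_space S A) (\<lambda>x. (a, x)))
        \<in> S \<Otimes>\<^sub>M A \<rightarrow>\<^sub>M prob_algebra (step_space S A)"
      by (simp add: case_prod_unfold) measurable
  qed
  then show ?thesis
    unfolding step_law_def[abs_def] .
qed

lemma (in mdp) Ionescu_Tulcea_traj:
  assumes \<pi>: "\<pi> \<in> S \<rightarrow>\<^sub>M prob_algebra A" and s: "s \<in> space S"
  shows "Ionescu_Tulcea (traj_kernel S A T \<pi> s) (\<lambda>_. step_space S A)"
proof -
  have st: "(\<lambda>\<omega>. state_at s \<omega> k) \<in> PiM {0..<k} (\<lambda>_. step_space S A) \<rightarrow>\<^sub>M S" for k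
  proof (cases k)
    case 0
    then show ?thesis using s by (simp add: state_at_def)
  next
    case (Suc j)
    have "(\<lambda>\<omega>. \<omega> j) \<in> PiM {0..<k} (\<lambda>_. step_space S A) \<rightarrow>\<^sub>M A \<Otimes>\<^sub>M (borel \<Otimes>\<^sub>M S)"
      using measurable_component_singleton[of j "{0..<k}" "\<lambda>_. step_space S A"] Suc
      by (simp add: step_space_def)
    then have "(\<lambda>\<omega>. snd (snd (\<omega> j))) \<in> PiM {0..<k} (\<lambda>_. step_space S A) \<rightarrow>\<^sub>M S"
      by measurable
    then show ?thesis using Suc by (simp add: state_at_def)
  qed
  have k: "traj_kernel S A T \<pi> s k
      \<in> PiM {0..<k} (\<lambda>_. step_space S A) \<rightarrow>\<^sub>M prob_algebra (step_space S A)" for k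
    unfolding traj_kernel_def[abs_def]
    by (rule measurable_compose[OF st step_law_measurable[OF \<pi>]])
  show ?thesis
  proof (rule Ionescu_Tulcea.intro)
    fix k
    show "traj_kernel S A T \<pi> s k
      \<in> PiM {0..<k} (\<lambda>_. step_space S A) \<rightarrow>\<^sub>M subprob_algebra (step_space S A)"
      by (rule measurable_prob_algebraD[OF k])
    fix \<omega> :: "('s, 'a) traj"
    assume "\<omega> \<in> space (PiM {0..<k} (\<lambda>_. step_space S A))"
    then show "prob_space (traj_kernel S A T \<pi> s k \<omega>)"
      using measurable_space[OF k] by (simp add: space_prob_algebra)
  qed
qed

end

theory Submission
  imports Defs
begin

text \<open>
  Conditionally on the sampled states, a row of \<open>n\<close> truncated returns lies in an interval of length
  \<open>2 G\<close>, \<open>G = R_max (1 - \<gamma>\<^sup>l) / (1 - \<gamma>)\<close>, while \<open>\<zeta>\<close> contains \<open>3 G\<close>. So an empirical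
  Bernstein bound with constant \<open>3/2\<close> times the range is needed, half the usual \<open>3\<close>. For range 1, centred
  variables \<open>Y\<^sub>j\<close> of variance \<open>q\<close>, \<open>S = \<Sum> Y\<^sub>j\<close>, \<open>Q = \<Sum> Y\<^sub>j\<^sup>2\<close> and confidence \<open>e\<^sup>-\<^sup>x\<close> it is obtained
  from three regimes. If \<open>n \<le> 9x/2\<close>, Hoeffding's inequality suffices. If \<open>n q \<le> 7x/2\<close>, a self-normalized
  Chernoff bound for \<open>r S - r\<^sup>2 Q\<close>, which never refers to \<open>q\<close>, covers moderate values of \<open>S\<close>, and
  Hoeffding's or Bernstein's inequality covers the rest. If \<open>n q \<ge> 7x/2\<close>, Bernstein's inequality for \<open>S\<close>
  is combined with a Poisson-type lower tail for \<open>Q\<close>.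

  A union bound over the \<open>m\<close> rows costs \<open>\<delta>/2\<close>. Chernoff's bound for the sub-exponential losses and a
  union bound over the \<open>K\<close> value functions cost another \<open>\<delta>/2\<close>, and truncation shifts the means by at most
  \<open>R_max \<gamma>\<^sup>l / (1 - \<gamma>)\<close>.
\<close>

section \<open>Real inequalities\<close>

lemma mono_from_deriv:
  fixes f f' :: "real \<Rightarrow> real"
  assumes "\<And>x. a \<le> x \<Longrightarrow> x \<le> b \<Longrightarrow> (f has_real_derivative f' x) (at x)"
    and "\<And>x. a \<le> x \<Longrightarrow> x \<le> b \<Longrightarrow> 0 \<le> f' x" and "a \<le> b"
  shows "f a \<le> f b"
  using DERIV_nonneg_imp_nondecreasing[of a b f] assms by blast

text \<open>With \<open>g t = t^2 / 2 - (exp t - 1 - t) * (1 - t / 3)\<close>, both \<open>g\<close>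
  and its derivative vanish at 0, and \<open>1 - t <= exp (- t)\<close> makes the second derivative
  nonnegative. Hence \<open>g\<close> is nonnegative on the whole line. Dividing by
  \<open>1 - y / 3\<close> and then shrinking this denominator to \<open>1 - c / 3\<close> gives the
  claim.\<close>

lemma exp_bernstein_bound:
  fixes y c :: real
  assumes "y \<le> c" "0 \<le> c" "c < 3"
  shows "exp y \<le> 1 + y + y\<^sup>2 / (2 * (1 - c / 3))"
proof -
  define g where "g = (\<lambda>t::real. t\<^sup>2 / 2 + (1 + t - exp t) * (1 - t / 3))"
  define g1 where "g1 = (\<lambda>t::real. t + (1 - exp t) * (1 - t / 3) - (1 + t - exp t) / 3)"
  define g2 where "g2 = (\<lambda>t::real. (1 + exp t * (t - 1)) / 3)"
  have d1: "(g has_real_derivative g1 t) (at t)" for t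
    unfolding g_def g1_def by (auto intro!: derivative_eq_intros simp: field_simps)
  have d2: "(g1 has_real_derivative g2 t) (at t)" for t
    unfolding g2_def g1_def by (auto intro!: derivative_eq_intros simp: field_simps)
  have g2_nonneg: "0 \<le> g2 t" for t
  proof -
    have "exp t * (1 - t) \<le> exp t * exp (-t)"
      using exp_ge_add_one_self[of "-t"] by (intro mult_left_mono) auto
    then show ?thesis by (simp add: g2_def exp_minus field_simps)
  qed
  have mono: "g1 s \<le> g1 t" if "s \<le> t" for s t
    by (rule mono_from_deriv[OF d2 g2_nonneg that])
  have "g1 0 = 0" "g 0 = 0" by (simp_all add: g_def g1_def)
  have "0 \<le> g y"
  proof (cases "0 \<le> y")
    case True
    then have "g 0 \<le> g y"
      using mono[of 0] \<open>g1 0 = 0\<close> by (intro mono_from_deriv[OF d1]) auto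
    then show ?thesis using \<open>g 0 = 0\<close> by simp
  next
    case False
    have "- g y \<le> - g 0"
    proof (rule mono_from_deriv[where f = "\<lambda>t. - g t" and f' = "\<lambda>t. - g1 t"])
      show "((\<lambda>t. - g t) has_real_derivative - g1 t) (at t)" for t
        by (rule DERIV_minus[OF d1])
    qed (use False mono[of _ 0] \<open>g1 0 = 0\<close> in auto)
    then show ?thesis using \<open>g 0 = 0\<close> by simp
  qed
  also have "g y = y\<^sup>2 / 2 - (exp y - 1 - y) * (1 - y / 3)"
    by (simp add: g_def algebra_simps)
  finally have "(exp y - 1 - y) * (1 - y / 3) \<le> y\<^sup>2 / 2" by simp
  then have "exp y - 1 - y \<le> y\<^sup>2 / 2 / (1 - y / 3)"
    using assms by (subst pos_le_divide_eq) auto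
  also have "\<dots> \<le> y\<^sup>2 / 2 / (1 - c / 3)"
    using assms by (intro divide_left_mono mult_pos_pos) auto
  finally show ?thesis by (simp add: field_simps)
qed

text \<open>Decides the sign at the left endpoint \<open>- (2/3)\<close> in the next lemma, where
  the function considered equals \<open>10/9 - ln 3\<close>. The exponential is bounded below by the
  eighth power of a quadratic Taylor polynomial.\<close>

lemma ln_3_le: "ln 3 \<le> (10/9 :: real)"
proof -
  have "3 \<le> (1 + (10/72) + (10/72)^2/2 :: real) ^ 8" by (simp add: field_simps eval_nat_numeral)
  also have "\<dots> \<le> exp (10/72) ^ 8"
    by (intro power_mono exp_lower_Taylor_quadratic) auto
  also have "\<dots> = exp (10/9 :: real)" by (simp flip: exp_of_nat_mult)
  finally show ?thesis by (metis exp_le_cancel_iff exp_ln zero_less_numeral)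
qed

text \<open>Makes \<open>exp (r Y - r^2 Y^2)\<close> have mean at most 1 for centred
  \<open>Y\<close>. The function \<open>ln (1 + t) - t + t^2\<close> has derivative
  \<open>t (1 + 2 t) / (1 + t)\<close>: it increases up to \<open>- (1/2)\<close>, decreases to its
  zero at 0, then increases again. So only 0 and the left endpoint have to be checked.\<close>

lemma exp_diff_square_le:
  fixes y :: real
  assumes "- (2 / 3) \<le> y"
  shows "exp (y - y\<^sup>2) \<le> 1 + y"
proof -
  define g where "g = (\<lambda>t::real. ln (1 + t) - t + t\<^sup>2)"
  have d: "(g has_real_derivative t * (1 + 2 * t) / (1 + t)) (at t)" if "- 1 < t" for t
    unfolding g_def using that
    by (auto intro!: derivative_eq_intros simp: field_simps power2_eq_square)
  have d': "((\<lambda>t. - g t) has_real_derivative - (t * (1 + 2 * t) / (1 + t))) (at t)" if "- 1 < t" for t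
    by (rule DERIV_minus[OF d[OF that]])
  have g0: "g 0 = 0" by (simp add: g_def)
  have "0 \<le> g y"
  proof -
    consider "0 \<le> y" | "- (1/2) \<le> y" "y \<le> 0" | "y \<le> - (1/2)" by linarith
    then show ?thesis
    proof cases
      case 1
      have "g 0 \<le> g y" by (rule mono_from_deriv[OF d]) (use 1 in auto)
      then show ?thesis using g0 by simp
    next
      case 2
      have "- g y \<le> - g 0"
        by (rule mono_from_deriv[OF d'])
          (use 2 in \<open>auto intro!: divide_nonpos_pos mult_nonpos_nonneg\<close>)
      then show ?thesis using g0 by simp
    next
      case 3
      have "g (- (2/3)) \<le> g y"
        by (rule mono_from_deriv[OF d])
          (use 3 assms in \<open>auto intro!: divide_nonneg_pos mult_nonpos_nonpos\<close>)
      moreover have "0 \<le> g (- (2/3))"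
        using ln_3_le by (simp add: g_def ln_div power2_eq_square)
      ultimately show ?thesis by simp
    qed
  qed
  then have "y - y\<^sup>2 \<le> ln (1 + y)" by (simp add: g_def)
  then show ?thesis using assms by (simp add: ln_ge_iff)
qed

text \<open>The two sides agree to second order, as \<open>1/2 - 1/8 = 3/8\<close>. The logarithmic
  difference has a derivative with the factor \<open>4 - 3 t\<close>, hence the limit
  \<open>4/3\<close>. It replaces an exact logarithm in the lower tail of \<open>Q\<close>.\<close>

lemma quadratic_le_exp:
  fixes p :: real
  assumes "0 \<le> p" "p \<le> 4 / 3"
  shows "1 + p + 3 * p\<^sup>2 / 8 \<le> exp (p - p\<^sup>2 / 8)"
proof -
  define g where "g = (\<lambda>t::real. t - t\<^sup>2 / 8 - ln (1 + t + 3 * t\<^sup>2 / 8))"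
  have pos: "0 < 1 + t + 3 * t\<^sup>2 / 8" if "0 \<le> t" for t :: real
    using that by (intro add_pos_nonneg) auto
  have d: "(g has_real_derivative t\<^sup>2 * (4 - 3 * t) / 32 / (1 + t + 3 * t\<^sup>2 / 8)) (at t)"
    if "0 \<le> t" for t
    unfolding g_def using pos[OF that]
    by (auto intro!: derivative_eq_intros simp: divide_simps) (simp add: algebra_simps power2_eq_square)
  have "g 0 \<le> g p"
    by (rule mono_from_deriv[OF d]) (use assms pos in \<open>auto intro!: divide_nonneg_pos\<close>)
  then have "ln (1 + p + 3 * p\<^sup>2 / 8) \<le> p - p\<^sup>2 / 8" by (simp add: g_def)
  then show ?thesis using pos[OF assms(1)] by (metis exp_le_cancel_iff exp_ln)
qed

lemma exp_neg_le_chord: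
  fixes r u :: real
  assumes "0 \<le> u" "u \<le> 1"
  shows "exp (- r * u) \<le> 1 - (1 - exp (- r)) * u"
proof -
  have "exp ((1 - u) * 0 + u * (- r)) \<le> (1 - u) * exp 0 + u * exp (- r)"
    using convex_onD[OF exp_convex, of u 0 "- r"] assms by simp
  then show ?thesis by (simp add: algebra_simps)
qed

text \<open>
  Here \<open>s\<close> and \<open>e\<close> stand for \<open>S / x\<close> and \<open>x / n\<close>, and \<open>1 / m\<close> is the parameter \<open>r\<close> of the self-normalized
  bound. At \<open>s = 3/2\<close> the two sides differ by \<open>9/8 e (1 - 9/2 e)\<close>, which is where \<open>e \<le> 2/9\<close> is sharp.
\<close>
lemma small_variance_certificate:
  fixes s e :: real
  assumes "3/2 \<le> s" "0 \<le> e" "e \<le> 2/9"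
    and tail: "e * s\<^sup>2 \<le> 7/10 \<and> 1/19 \<le> e \<or> s \<le> 73/20 \<and> e \<le> 1/19"
  defines "m \<equiv> 3/2 - 9/4 * e"
  shows "m\<^sup>2 + (s - 3/2)\<^sup>2 / 2 + e * s\<^sup>2 \<le> m * s"
proof -
  define y where "y = s - 3/2"
  have y: "0 \<le> y" using assms by (simp add: y_def)
  \<comment> \<open>Right side minus left side equals
    \<open>9/8 e (1 - 9/2 e) + y (3/2 - 21/4 e - y (1/2 + e))\<close>, so it remains to see that the
    last bracket is nonnegative.\<close>
  have key: "y * (1/2 + e) \<le> 3/2 - 21/4 * e"
    using tail
  proof
    assume h: "s \<le> 73/20 \<and> e \<le> 1/19"
    have "y * (1/2 + e) \<le> 43/20 * (1/2 + 1/19)"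
      using h assms by (intro mult_mono) (auto simp: y_def)
    then show ?thesis using h by simp
  next
    assume h: "e * s\<^sup>2 \<le> 7/10 \<and> 1/19 \<le> e"
    show ?thesis
    proof (cases "s \<le> 7/4")
      case True
      have "y * (1/2 + e) \<le> 1/4 * (1/2 + 2/9)"
        using True assms by (intro mult_mono) (auto simp: y_def)
      then show ?thesis using assms by simp
    next
      case False
      have s2: "s\<^sup>2 \<le> 133/10"
      proof -
        have "1/19 * s\<^sup>2 \<le> e * s\<^sup>2" using h by (intro mult_right_mono) auto
        then show ?thesis using h by simp
      qed
      then have s_le: "s \<le> 73/20"
        by (intro power2_le_imp_le[of s]) (auto simp: power2_eq_square)
      have "s\<^sup>2 * (y * (1/2 + e)) = y * (s\<^sup>2 / 2 + e * s\<^sup>2)" by (simp add: algebra_simps)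
      also have "\<dots> \<le> y * (s\<^sup>2 / 2 + 7/10)" using h y by (intro mult_left_mono) auto
      also have "\<dots> \<le> 3/2 * s\<^sup>2 - 147/40"
      proof -
        \<comment> \<open>Multiplication by \<open>s^2\<close> has replaced \<open>e s^2\<close> by
          the constant \<open>7/10\<close>, leaving a cubic in \<open>s\<close> alone. It exceeds
          this product by a positive linear term. The product is nonnegative between
          \<open>7/4\<close> and \<open>73/20\<close>, and \<open>73/20\<close> is just above the
          square root of \<open>133/10\<close>.\<close>
        have "0 \<le> (s - 7/4) * (73/20 - s) * (s / 2 + 9/20)"
          using False s_le by (intro mult_nonneg_nonneg) auto
        also have "\<dots> = 3/2 * s\<^sup>2 - 147/40 - y * (s\<^sup>2 / 2 + 7/10) - (51/800 * s + 399/1600)"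
          unfolding y_def by (simp add: field_simps power2_eq_square)
        finally show ?thesis using False by linarith
      qed
      also have "\<dots> \<le> s\<^sup>2 * (3/2 - 21/4 * e)" using h by (simp add: algebra_simps)
      finally show ?thesis using False by (simp add: mult_le_cancel_left_pos)
    qed
  qed
  have "0 \<le> 9/8 * e * (1 - 9/2 * e) + y * (3/2 - 21/4 * e - y * (1/2 + e))"
    using assms y key by (intro add_nonneg_nonneg mult_nonneg_nonneg) auto
  also have "\<dots> = m * s - (m\<^sup>2 + (s - 3/2)\<^sup>2 / 2 + e * s\<^sup>2)"
    unfolding m_def y_def by (simp add: field_simps power2_eq_square)
  finally show ?thesis by simp
qed

text \<open>Here \<open>z\<^sup>2 = 2 n q / x\<close>; the right-hand side is \<open>2 / x\<close> times the lower-tail threshold for \<open>Q\<close>.\<close>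
lemma large_variance_certificate:
  fixes z q s :: real
  assumes z: "7 \<le> z\<^sup>2" "0 \<le> z" and q: "0 \<le> q" "q \<le> 1/4"
    and s: "3/2 \<le> s" "s \<le> z + (1 - q) / 3"
  shows "(s - 3/2)\<^sup>2 + 4 * q / z\<^sup>2 * s\<^sup>2 \<le> (z - 11/10 * (1 - q))\<^sup>2"
proof -
  have z_ge: "529/200 \<le> z"
  proof (rule power2_le_imp_le)
    have "(529/200 :: real)\<^sup>2 \<le> 7" by (simp add: power2_eq_square)
    then show "(529/200)\<^sup>2 \<le> z\<^sup>2" using z(1) by linarith
  qed fact
  define b where "b = 1 - q"
  have b: "3/4 \<le> b" "b \<le> 1" using q by (auto simp: b_def)
  have "(s - 3/2)\<^sup>2 \<le> (z + b / 3 - 3/2)\<^sup>2"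
    using s by (intro power_mono) (auto simp: b_def)
  moreover have "4 * q / z\<^sup>2 * s\<^sup>2 \<le> 4 * q * (1127/1000)\<^sup>2"
  proof -
    have "s \<le> z + 1/3" using s q by (simp add: field_simps)
    also have "\<dots> \<le> 1127/1000 * z" using z_ge by simp
    finally have "s\<^sup>2 \<le> (1127/1000 * z)\<^sup>2" using s by (intro power_mono) auto
    then have "s\<^sup>2 / z\<^sup>2 \<le> (1127/1000)\<^sup>2"
      using z_ge by (simp add: power_mult_distrib divide_simps)
    then have "4 * q * (s\<^sup>2 / z\<^sup>2) \<le> 4 * q * (1127/1000)\<^sup>2" using q by (intro mult_left_mono) auto
    then show ?thesis by simp
  qed
  moreover have "(z + b / 3 - 3/2)\<^sup>2 + 4 * q * (1127/1000)\<^sup>2 \<le> (z - 11/10 * b)\<^sup>2"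
  proof -
    \<comment> \<open>The difference of the squares \<open>(z - 11/10 b)^2\<close> and
      \<open>(z + b/3 - 3/2)^2\<close> factors as this product. Its first factor is positive, so
      \<open>z\<close> may be replaced by its lower bound, and a quadratic in \<open>q\<close> is
      left.\<close>
    have "(3/2 - 43/30 * b) * (2 * (529/200) - 23/30 * b - 3/2) \<le> (3/2 - 43/30 * b) * (2 * z - 23/30 * b - 3/2)"
      using z_ge b by (intro mult_left_mono) auto
    moreover have "4 * q * (1127/1000)\<^sup>2 \<le> (3/2 - 43/30 * b) * (2 * (529/200) - 23/30 * b - 3/2)"
    proof -
      have "(3/2 - 43/30 * b) * (2 * (529/200) - 23/30 * b - 3/2) \<ge> 1/5 + 438/100 * q"
        using q unfolding b_def by (simp add: field_simps)
      then show ?thesis using q by (simp add: power2_eq_square)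
    qed
    ultimately show ?thesis by (simp add: algebra_simps power2_eq_square)
  qed
  ultimately show ?thesis by (simp add: b_def)
qed

section \<open>Empirical Bernstein inequality\<close>

context prob_space begin

text \<open>Markov's inequality for the exponential of the sum, whose moment factors by
  independence. Nonnegative integrals let one hypothesis express both finiteness and size of the
  moment. The transform \<open>\<phi>\<close> is general because the self-normalized and the
  second-moment tails use quadratic ones.\<close>

lemma chernoff_indep_vars:
  fixes Y :: "'i \<Rightarrow> 'a \<Rightarrow> real" and \<phi> :: "real \<Rightarrow> real"
  assumes "finite I" and indep: "indep_vars (\<lambda>_. borel) Y I"
    and [measurable]: "\<phi> \<in> borel_measurable borel"
    and mgf: "\<And>j. j \<in> I \<Longrightarrow> (\<integral>\<^sup>+\<omega>. ennreal (exp (\<phi> (Y j \<omega>))) \<partial>M) \<le> ennreal (exp \<kappa>)"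
  shows "prob {\<omega> \<in> space M. real (card I) * \<kappa> + c \<le> (\<Sum>j\<in>I. \<phi> (Y j \<omega>))} \<le> exp (- c)"
proof -
  have [measurable]: "Y j \<in> borel_measurable M" if "j \<in> I" for j
    using indep that by (auto simp: indep_vars_def)
  define k where "k = real (card I) * \<kappa> + c"
  \<comment> \<open>The event is put in the form \<open>1 <= c * u\<close> expected by Markov's
    inequality for nonnegative integrals.\<close>
  have "emeasure M {\<omega> \<in> space M. k \<le> (\<Sum>j\<in>I. \<phi> (Y j \<omega>))}
      = emeasure M ({\<omega> \<in> space M. 1 \<le> ennreal (exp (- k)) * (\<Prod>j\<in>I. ennreal (exp (\<phi> (Y j \<omega>))))})"
    by (intro arg_cong[where f = "emeasure M"])
      (auto simp: prod_ennreal exp_sum[OF \<open>finite I\<close>, symmetric] exp_minus field_simps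
        simp flip: ennreal_mult' ennreal_1 exp_add exp_diff)
  also have "\<dots> \<le> ennreal (exp (- k)) * (\<integral>\<^sup>+\<omega>. (\<Prod>j\<in>I. ennreal (exp (\<phi> (Y j \<omega>)))) * indicator (space M) \<omega> \<partial>M)"
    using nn_integral_Markov_inequality[of "\<lambda>\<omega>. \<Prod>j\<in>I. ennreal (exp (\<phi> (Y j \<omega>)))" "space M" M "ennreal (exp (- k))"]
    by (simp add: Int_def conj_commute)
  also have "(\<integral>\<^sup>+\<omega>. (\<Prod>j\<in>I. ennreal (exp (\<phi> (Y j \<omega>)))) * indicator (space M) \<omega> \<partial>M)
      = (\<integral>\<^sup>+\<omega>. (\<Prod>j\<in>I. ennreal (exp (\<phi> (Y j \<omega>)))) \<partial>M)"
    by (intro nn_integral_cong) simp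
  also have "\<dots> = (\<Prod>j\<in>I. \<integral>\<^sup>+\<omega>. ennreal (exp (\<phi> (Y j \<omega>))) \<partial>M)"
    by (intro indep_vars_nn_integral \<open>finite I\<close> indep_vars_compose2[OF indep]) auto
  also have "\<dots> \<le> (\<Prod>j\<in>I. ennreal (exp \<kappa>))"
    by (intro prod_mono_ennreal mgf)
  also have "\<dots> = ennreal (exp (real (card I) * \<kappa>))"
    by (simp add: exp_of_nat_mult ennreal_power)
  also have "ennreal (exp (- k)) * ennreal (exp (real (card I) * \<kappa>)) = ennreal (exp (- c))"
    by (simp add: k_def flip: ennreal_mult' exp_add)
  finally show ?thesis
    by (simp add: k_def emeasure_eq_measure mult_left_mono)
qed

end

text \<open>The parameter \<open>b\<close> records where the mean sits inside an interval of length
  one. The one-sided ranges \<open>b\<close> and \<open>1 - b\<close> are kept apart because the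
  sharp constant uses them separately; negating \<open>Y\<close> exchanges them.\<close>

locale centered_sample = prob_space +
  fixes Y :: "nat \<Rightarrow> 'a \<Rightarrow> real" and n :: nat and b q :: real
  assumes indep: "indep_vars (\<lambda>_. borel) Y {..<n}"
    and range: "\<And>j. j < n \<Longrightarrow> AE \<omega> in M. - b \<le> Y j \<omega> \<and> Y j \<omega> \<le> 1 - b"
    and mean: "\<And>j. j < n \<Longrightarrow> expectation (Y j) = 0"
    and second_moment: "\<And>j. j < n \<Longrightarrow> expectation (\<lambda>\<omega>. (Y j \<omega>)\<^sup>2) = q"
begin

lemma measurable_Y [measurable]: "j < n \<Longrightarrow> Y j \<in> borel_measurable M"
  using indep by (auto simp: indep_vars_def)

lemma integrable_Y: "j < n \<Longrightarrow> integrable M (Y j)"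
  by (rule integrable_const_bound[where B = "\<bar>b\<bar> + 1"]) (use range[of j] in auto)

lemma integrable_Y2: "j < n \<Longrightarrow> integrable M (\<lambda>\<omega>. (Y j \<omega>)\<^sup>2)"
proof (rule integrable_const_bound[where B = "(\<bar>b\<bar> + 1)\<^sup>2"])
  assume j: "j < n"
  show "AE \<omega> in M. norm ((Y j \<omega>)\<^sup>2) \<le> (\<bar>b\<bar> + 1)\<^sup>2"
    using range[OF j] by eventually_elim (auto simp: abs_le_square_iff[symmetric])
qed auto

text \<open>Integrating the quadratic majorant removes the linear term by centring and leaves
  \<open>1 + v q\<close>, which is at most \<open>exp (v q)\<close>.\<close>

lemma mgf_le:
  assumes j: "j < n" and \<phi>: "\<phi> \<in> borel_measurable borel"
    and le: "AE \<omega> in M. exp (\<phi> (Y j \<omega>)) \<le> 1 + u * Y j \<omega> + v * (Y j \<omega>)\<^sup>2"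
  shows "(\<integral>\<^sup>+\<omega>. ennreal (exp (\<phi> (Y j \<omega>))) \<partial>M) \<le> ennreal (exp (v * q))"
proof -
  note [measurable] = measurable_Y[OF j] \<phi>
  note [simp] = integrable_Y[OF j] integrable_Y2[OF j]
  have "(\<integral>\<^sup>+\<omega>. ennreal (exp (\<phi> (Y j \<omega>))) \<partial>M)
      \<le> (\<integral>\<^sup>+\<omega>. ennreal (1 + u * Y j \<omega> + v * (Y j \<omega>)\<^sup>2) \<partial>M)"
    using le by (intro nn_integral_mono_AE) (auto intro: ennreal_leI)
  also have "\<dots> = ennreal (\<integral>\<omega>. 1 + u * Y j \<omega> + v * (Y j \<omega>)\<^sup>2 \<partial>M)"
  proof (rule nn_integral_eq_integral)
    show "AE \<omega> in M. 0 \<le> 1 + u * Y j \<omega> + v * (Y j \<omega>)\<^sup>2"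
      using le by eventually_elim (metis exp_ge_zero order_trans)
  qed simp
  also have "(\<integral>\<omega>. 1 + u * Y j \<omega> + v * (Y j \<omega>)\<^sup>2 \<partial>M) = 1 + v * q"
    using mean[OF j] second_moment[OF j] by (simp add: prob_space)
  also have "ennreal (1 + v * q) \<le> ennreal (exp (v * q))"
    by (intro ennreal_leI exp_ge_add_one_self)
  finally show ?thesis .
qed

text \<open>Every tail below except Hoeffding's comes from this by choosing \<open>\<phi>\<close>
  and a quadratic majorant of its exponential on the range of \<open>Y\<close>.\<close>

lemma chernoff:
  assumes \<phi>: "\<phi> \<in> borel_measurable borel"
    and le: "\<And>y. - b \<le> y \<Longrightarrow> y \<le> 1 - b \<Longrightarrow> exp (\<phi> y) \<le> 1 + u * y + v * y\<^sup>2"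
  shows "prob {\<omega> \<in> space M. real n * (v * q) + c \<le> (\<Sum>j<n. \<phi> (Y j \<omega>))} \<le> exp (- c)"
proof -
  have "(\<integral>\<^sup>+\<omega>. ennreal (exp (\<phi> (Y j \<omega>))) \<partial>M) \<le> ennreal (exp (v * q))" if "j \<in> {..<n}" for j
  proof (rule mgf_le[OF _ \<phi>])
    show "AE \<omega> in M. exp (\<phi> (Y j \<omega>)) \<le> 1 + u * Y j \<omega> + v * (Y j \<omega>)\<^sup>2"
      using range[of j] that by (auto intro: le)
  qed (use that in auto)
  from chernoff_indep_vars[OF _ indep \<phi> this] show ?thesis by simp
qed

lemma hoeffding_tail:
  assumes "0 < n" "0 < c"
  shows "prob {\<omega> \<in> space M. c \<le> (\<Sum>j<n. Y j \<omega>)} \<le> exp (- (2 * c\<^sup>2 / real n))"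
proof -
  \<comment> \<open>The minimizer of \<open>n r^2 / 8 - r c\<close>.\<close>
  define r where "r = 4 * c / real n"
  have r: "0 < r" using assms by (simp add: r_def)
  have "(\<integral>\<^sup>+\<omega>. ennreal (exp (r * Y j \<omega>)) \<partial>M) \<le> ennreal (exp (r\<^sup>2 / 8))" if "j \<in> {..<n}" for j
  proof -
    interpret interval_bounded_random_variable M "Y j" "- b" "1 - b"
      using that range[of j] by unfold_locales auto
    show ?thesis
      using Hoeffdings_lemma_nn_integral_0[OF r] mean that by simp
  qed
  from chernoff_indep_vars[OF _ indep _ this, of "2 * c\<^sup>2 / real n"]
  have "prob {\<omega> \<in> space M. real n * (r\<^sup>2 / 8) + 2 * c\<^sup>2 / real n \<le> (\<Sum>j<n. r * Y j \<omega>)}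
      \<le> exp (- (2 * c\<^sup>2 / real n))"
    by simp
  also have "real n * (r\<^sup>2 / 8) + 2 * c\<^sup>2 / real n = r * c"
    using assms by (simp add: r_def field_simps power2_eq_square)
  finally show ?thesis using r by (simp flip: sum_distrib_left)
qed

text \<open>The majorant is \<open>exp_bernstein_bound\<close> with \<open>r y <= r d\<close>. The
  parameter \<open>r\<close> stays free: it is a fixed number in one regime and tuned to the
  variance in another.\<close>

lemma bernstein_tail:
  assumes "0 < r" "1 - b \<le> d" "0 \<le> d" "r * d < 3"
    and k: "k = r * c - real n * q * r\<^sup>2 / (2 * (1 - r * d / 3))"
  shows "prob {\<omega> \<in> space M. c \<le> (\<Sum>j<n. Y j \<omega>)} \<le> exp (- k)"
proof -
  define v where "v = r\<^sup>2 / (2 * (1 - r * d / 3))"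
  have "prob {\<omega> \<in> space M. real n * (v * q) + k \<le> (\<Sum>j<n. r * Y j \<omega>)} \<le> exp (- k)"
  proof (rule chernoff[where u = r])
    fix y assume "- b \<le> y" "y \<le> 1 - b"
    then have "r * y \<le> r * d" using assms by (intro mult_left_mono) auto
    then show "exp (r * y) \<le> 1 + r * y + v * y\<^sup>2"
      using exp_bernstein_bound[of "r * y" "r * d"] assms
      by (simp add: v_def power_mult_distrib)
  qed simp
  moreover have "real n * (v * q) + k = r * c" by (simp add: k v_def)
  ultimately show ?thesis using \<open>0 < r\<close> by (simp flip: sum_distrib_left)
qed

text \<open>Since \<open>r Y >= - r b >= - 2/3\<close>, the majorant from
  \<open>exp_diff_square_le\<close> is linear. With \<open>v = 0\<close> the moment bound is 1
  whatever the variance.\<close>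

lemma self_normalized_tail:
  assumes "0 \<le> r" "r * b \<le> 2 / 3"
  shows "prob {\<omega> \<in> space M. c \<le> r * (\<Sum>j<n. Y j \<omega>) - r\<^sup>2 * (\<Sum>j<n. (Y j \<omega>)\<^sup>2)} \<le> exp (- c)"
proof -
  have "prob {\<omega> \<in> space M. real n * (0 * q) + c \<le> (\<Sum>j<n. r * Y j \<omega> - (r * Y j \<omega>)\<^sup>2)} \<le> exp (- c)"
  proof (rule chernoff[where u = r])
    fix y assume "- b \<le> y" "y \<le> 1 - b"
    then have "r * (- b) \<le> r * y" using assms by (intro mult_left_mono) auto
    then show "exp (r * y - (r * y)\<^sup>2) \<le> 1 + r * y + 0 * y\<^sup>2"
      using exp_diff_square_le[of "r * y"] assms by simp
  qed simp
  then show ?thesis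
    by (simp add: sum_subtractf power_mult_distrib flip: sum_distrib_left)
qed

text \<open>On the unit interval \<open>exp (- \<tau> u)\<close> lies below its chord. Applied to
  \<open>u = Y^2 / d^2\<close>, this gives the exponent of a Poisson lower tail, with
  \<open>\<tau>\<close> left to be optimized.\<close>

lemma second_moment_lower_tail:
  assumes "0 < d" "b \<le> d" "1 - b \<le> d" "0 \<le> \<tau>"
    and k: "k = ((1 - exp (- \<tau>)) * (real n * q) - \<tau> * c) / d\<^sup>2"
  shows "prob {\<omega> \<in> space M. (\<Sum>j<n. (Y j \<omega>)\<^sup>2) \<le> c} \<le> exp (- k)"
proof -
  define v where "v = - (1 - exp (- \<tau>)) / d\<^sup>2"
  have "prob {\<omega> \<in> space M. real n * (v * q) + k \<le> (\<Sum>j<n. - \<tau> * ((Y j \<omega>)\<^sup>2 / d\<^sup>2))} \<le> exp (- k)"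
  proof (rule chernoff[where u = 0])
    fix y assume "- b \<le> y" "y \<le> 1 - b"
    then have "y\<^sup>2 \<le> d\<^sup>2" using assms by (intro abs_le_square_iff[THEN iffD1]) auto
    then have "y\<^sup>2 / d\<^sup>2 \<le> 1" using assms by simp
    then show "exp (- \<tau> * (y\<^sup>2 / d\<^sup>2)) \<le> 1 + 0 * y + v * y\<^sup>2"
      using exp_neg_le_chord[of "y\<^sup>2 / d\<^sup>2" \<tau>] by (simp add: v_def algebra_simps diff_divide_distrib)
  qed simp
  moreover have "real n * (v * q) + k = - \<tau> * c / d\<^sup>2"
    using assms by (simp add: k v_def field_simps)
  moreover have "(\<Sum>j<n. - \<tau> * ((Y j \<omega>)\<^sup>2 / d\<^sup>2)) = - \<tau> * (\<Sum>j<n. (Y j \<omega>)\<^sup>2) / d\<^sup>2" for \<omega>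
    by (simp add: sum_distrib_left sum_divide_distrib)
  ultimately have "prob {\<omega> \<in> space M. - \<tau> * c / d\<^sup>2 \<le> - \<tau> * (\<Sum>j<n. (Y j \<omega>)\<^sup>2) / d\<^sup>2} \<le> exp (- k)"
    by simp
  moreover have "prob {\<omega> \<in> space M. (\<Sum>j<n. (Y j \<omega>)\<^sup>2) \<le> c}
      \<le> prob {\<omega> \<in> space M. - \<tau> * c / d\<^sup>2 \<le> - \<tau> * (\<Sum>j<n. (Y j \<omega>)\<^sup>2) / d\<^sup>2}"
    using assms by (intro finite_measure_mono) (auto intro!: divide_right_mono mult_left_mono)
  ultimately show ?thesis by simp
qed

text \<open>The product of the distances of \<open>Y\<close> to the two ends of its range is almost
  surely nonnegative; its expectation is \<open>b (1 - b) - q\<close>.\<close>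

lemma variance_le:
  assumes "0 < n"
  shows "q \<le> b * (1 - b)" "0 \<le> q"
proof -
  note [simp] = integrable_Y[OF assms] integrable_Y2[OF assms]
  have "0 \<le> (\<integral>\<omega>. (Y 0 \<omega> + b) * (1 - b - Y 0 \<omega>) \<partial>M)"
    using range[OF assms] by (intro integral_nonneg_AE) auto
  also have "(\<lambda>\<omega>. (Y 0 \<omega> + b) * (1 - b - Y 0 \<omega>)) = (\<lambda>\<omega>. b * (1 - b) + (1 - 2 * b) * Y 0 \<omega> - (Y 0 \<omega>)\<^sup>2)"
    by (auto simp: algebra_simps power2_eq_square)
  also have "(\<integral>\<omega>. b * (1 - b) + (1 - 2 * b) * Y 0 \<omega> - (Y 0 \<omega>)\<^sup>2 \<partial>M) = b * (1 - b) - q"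
    using mean[OF assms] second_moment[OF assms] by (simp add: prob_space)
  finally show "q \<le> b * (1 - b)" by simp
  show "0 \<le> q" unfolding second_moment[OF assms, symmetric] by simp
qed

lemma centered_sample_uminus: "centered_sample M (\<lambda>j \<omega>. - Y j \<omega>) n (1 - b) q"
proof unfold_locales
  show "indep_vars (\<lambda>_. borel) (\<lambda>j \<omega>. - Y j \<omega>) {..<n}"
    by (rule indep_vars_compose2[OF indep]) auto
  show "AE \<omega> in M. - (1 - b) \<le> - Y j \<omega> \<and> - Y j \<omega> \<le> 1 - (1 - b)" if "j < n" for j
    using range[OF that] by eventually_elim auto
qed (use mean second_moment in auto)

end

section \<open>Deviation events and the three regimes\<close>

lemma sqrt_less_imp_less_square:
  fixes a t :: real
  assumes "sqrt a < t" "0 \<le> t"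
  shows "a < t\<^sup>2"
  using assms by (metis not_le real_le_rsqrt)

context centered_sample begin

abbreviation "S \<omega> \<equiv> \<Sum>j<n. Y j \<omega>"
abbreviation "Q \<omega> \<equiv> \<Sum>j<n. (Y j \<omega>)\<^sup>2"

text \<open>\<open>Q - S^2 / n\<close> is \<open>n\<close> times the empirical variance, so this is
  one side of the failure event, written for the sum instead of the mean and for variables scaled to
  range one.\<close>

definition upper_deviation :: "real \<Rightarrow> 'a set" where
  "upper_deviation x = {\<omega> \<in> space M. 3 / 2 * x + sqrt (2 * x * (Q \<omega> - (S \<omega>)\<^sup>2 / real n)) < S \<omega>}"

lemma upper_deviation_sets [measurable]: "upper_deviation x \<in> events"
  unfolding upper_deviation_def by measurable

text \<open>Squaring shows that a large deviation forces \<open>Q\<close> to be small relative to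
  \<open>S\<close>. Dividing by \<open>x\<close> leaves an inequality in \<open>s\<close>,
  \<open>e\<close> and \<open>Q / x\<close> that the polynomial certificates can contradict or
  exploit.\<close>

lemma upper_deviationD:
  assumes "\<omega> \<in> upper_deviation x" "0 < x" "0 < n" and s: "s = S \<omega> / x" and e: "e = x / real n"
    and nonneg: "0 \<le> Q \<omega> - (S \<omega>)\<^sup>2 / real n"
  shows "3 / 2 \<le> s" "Q \<omega> / x < (s - 3 / 2)\<^sup>2 / 2 + e * s\<^sup>2"
proof -
  have dev: "sqrt (2 * x * (Q \<omega> - (S \<omega>)\<^sup>2 / real n)) < S \<omega> - 3 / 2 * x"
    using assms(1) by (simp add: upper_deviation_def)
  have "0 \<le> sqrt (2 * x * (Q \<omega> - (S \<omega>)\<^sup>2 / real n))"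
    using nonneg assms by simp
  with dev have pos: "0 \<le> S \<omega> - 3 / 2 * x" by linarith
  then show "3 / 2 \<le> s" using \<open>0 < x\<close> by (simp add: s field_simps)
  have S: "S \<omega> = s * x" using \<open>0 < x\<close> by (simp add: s)
  have "2 * x * (Q \<omega> - (s * x)\<^sup>2 / real n) < (s * x - 3 / 2 * x)\<^sup>2"
    using sqrt_less_imp_less_square[OF dev pos] by (simp add: S)
  also have "2 * x * (Q \<omega> - (s * x)\<^sup>2 / real n) = 2 * x\<^sup>2 * (Q \<omega> / x - e * s\<^sup>2)"
    using assms by (simp add: e field_simps power2_eq_square)
  also have "(s * x - 3 / 2 * x)\<^sup>2 = 2 * x\<^sup>2 * ((s - 3 / 2)\<^sup>2 / 2)"
    by (simp add: field_simps power2_eq_square)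
  finally have "Q \<omega> / x - e * s\<^sup>2 < (s - 3 / 2)\<^sup>2 / 2"
    using \<open>0 < x\<close> mult_less_cancel_left_pos[of "2 * x\<^sup>2"] by (metis zero_less_mult_iff zero_less_numeral zero_less_power)
  then show "Q \<omega> / x < (s - 3 / 2)\<^sup>2 / 2 + e * s\<^sup>2" by linarith
qed

lemma empirical_variance_nonneg: "0 < n \<Longrightarrow> 0 \<le> Q \<omega> - (S \<omega>)\<^sup>2 / real n"
proof -
  assume "0 < n"
  have "0 \<le> (\<Sum>j<n. (Y j \<omega> - S \<omega> / real n)\<^sup>2)" by (intro sum_nonneg) auto
  also have "\<dots> = (\<Sum>j<n. (Y j \<omega>)\<^sup>2 - 2 * (S \<omega> / real n) * Y j \<omega> + (S \<omega> / real n)\<^sup>2)"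
    by (intro sum.cong) (simp_all add: power2_diff)
  also have "\<dots> = Q \<omega> - 2 * (S \<omega> / real n) * S \<omega> + real n * (S \<omega> / real n)\<^sup>2"
    by (simp add: sum.distrib sum_subtractf sum_distrib_left)
  also have "\<dots> = Q \<omega> - (S \<omega>)\<^sup>2 / real n"
    using \<open>0 < n\<close> by (simp add: field_simps power2_eq_square)
  finally show ?thesis .
qed

text \<open>All follow from \<open>q <= b (1 - b)\<close>, which is at most \<open>b\<close> and at
  most \<open>1 - b\<close>. The shrunken range \<open>1 - q\<close> is what sharpens Bernstein's
  inequality when the variance is large.\<close>

lemma b_range:
  assumes "0 < n"
  shows "0 \<le> b" "b \<le> 1" "b \<le> 1 - q" "1 - b \<le> 1 - q" "q \<le> 1 / 4"
proof -
  have "0 \<le> b * (1 - b)" using variance_le[OF assms] by linarith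
  then show b: "0 \<le> b" "b \<le> 1" by (auto simp: zero_le_mult_iff)
  have "b * (1 - b) \<le> 1 * (1 - b)" "b * (1 - b) \<le> b * 1"
    using b by (auto intro: mult_left_le mult_left_le_one_le)
  then show "b \<le> 1 - q" "1 - b \<le> 1 - q" using variance_le[OF assms] by auto
  have "b * (1 - b) \<le> 1 / 4"
    using mult_const_minus_self_real_le[of b 1] by simp
  then show "q \<le> 1 / 4" using variance_le[OF assms] by linarith
qed

text \<open>The deviation exceeds \<open>3/2 x\<close> in any case, and Hoeffding's exponent there
  is \<open>9/2 x^2 / n\<close>, which is at least \<open>x\<close> in this regime.\<close>

lemma upper_deviation_few_samples:
  assumes "0 < n" "0 < x" "2 / 9 \<le> x / real n"
  shows "prob (upper_deviation x) \<le> exp (- x)"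
proof -
  have "prob (upper_deviation x) \<le> prob {\<omega> \<in> space M. 3 / 2 * x \<le> S \<omega>}"
  proof (intro finite_measure_mono subsetI CollectI conjI)
    fix \<omega> assume dev: "\<omega> \<in> upper_deviation x"
    then show "\<omega> \<in> space M" by (simp add: upper_deviation_def)
    have "0 \<le> sqrt (2 * x * (Q \<omega> - (S \<omega>)\<^sup>2 / real n))"
      using empirical_variance_nonneg[OF assms(1)] assms by simp
    then show "3 / 2 * x \<le> S \<omega>" using dev unfolding upper_deviation_def mem_Collect_eq by linarith
  qed simp
  also have "\<dots> \<le> exp (- (2 * (3 / 2 * x)\<^sup>2 / real n))"
    using assms by (intro hoeffding_tail) auto
  also have "\<dots> \<le> exp (- x)"
  proof -
    have "x * (2 / 9) \<le> x * (x / real n)" using assms by (intro mult_left_mono) auto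
    then show ?thesis using assms by (simp add: field_simps power2_eq_square)
  qed
  finally show ?thesis .
qed

text \<open>Either \<open>S\<close> reaches \<open>c x\<close>, which costs the second exponential,
  or \<open>S\<close> is moderate and the certificate places the outcome in the self-normalized
  event. The second exponential is at most half of the first once \<open>x >= ln 6\<close>.\<close>

lemma upper_deviation_small_variance:
  assumes n: "0 < n" and x: "0 < x" and e_le: "x / real n \<le> 2 / 9" and q: "real n * q \<le> 7 / 2 * x"
  shows "prob (upper_deviation x) \<le> exp (- x) + exp (- (7 / 5 * x))"
proof (cases "b \<le> 1 - 3 / 2 * (x / real n)")
  case False
  \<comment> \<open>No \<open>Y\<^sub>j\<close> exceeds \<open>1 - b\<close>, so \<open>S\<close> cannot reach \<open>3/2 x\<close>. Otherwise the bound on \<open>b\<close> keeps \<open>r b \<le> 2/3\<close>.\<close>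
  have "AE \<omega> in M. \<forall>j<n. Y j \<omega> \<le> 1 - b"
    unfolding AE_all_countable
  proof
    show "AE \<omega> in M. j < n \<longrightarrow> Y j \<omega> \<le> 1 - b" for j
      using range[of j] by (cases "j < n") auto
  qed
  then have "AE \<omega> in M. \<omega> \<notin> upper_deviation x"
  proof eventually_elim
    case (elim \<omega>)
    have "S \<omega> \<le> (\<Sum>j<n. 1 - b)" using elim by (intro sum_mono) auto
    also have "\<dots> = real n * (1 - b)" by simp
    also have "\<dots> \<le> real n * (3 / 2 * (x / real n))" using False by (intro mult_left_mono) auto
    also have "\<dots> = 3 / 2 * x" using n by simp
    finally have "S \<omega> \<le> 3 / 2 * x" .
    moreover have "0 \<le> sqrt (2 * x * (Q \<omega> - (S \<omega>)\<^sup>2 / real n))"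
      using empirical_variance_nonneg[OF n] x by simp
    ultimately show ?case unfolding upper_deviation_def mem_Collect_eq by linarith
  qed
  then have "prob (upper_deviation x) = 0"
    by (subst prob_eq_0) auto
  then show ?thesis by (simp add: add_nonneg_nonneg)
next
  case True
  define e where "e = x / real n"
  have e: "0 < e" "e \<le> 2 / 9" using assms by (auto simp: e_def)
  \<comment> \<open>For \<open>e >= 1/19\<close> Hoeffding's exponent at \<open>c x\<close> is
    exactly \<open>7/5 x\<close>. For smaller \<open>e\<close>, Bernstein with
    \<open>r = 3/4\<close> and \<open>d = 1\<close> gives at least
    \<open>(3/4 * 73/20 - 3/8 * 7/2) x\<close>, again above \<open>7/5 x\<close>. The two values of
    \<open>c\<close> nearly agree at \<open>e = 1/19\<close>.\<close>
  define c where "c = (if 1 / 19 \<le> e then sqrt (7 / (10 * e)) else 73 / 20)"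
  have c: "0 < c" using e by (auto simp: c_def)
  have tail: "prob {\<omega> \<in> space M. c * x \<le> S \<omega>} \<le> exp (- (7 / 5 * x))"
  proof (cases "1 / 19 \<le> e")
    case True
    have "2 * (c * x)\<^sup>2 / real n = 2 * c\<^sup>2 * e * x" by (simp add: e_def power2_eq_square)
    also have "\<dots> = 7 / 5 * x" using True e by (simp add: c_def)
    finally show ?thesis using hoeffding_tail[OF n, of "c * x"] c x by (metis mult_pos_pos)
  next
    case False
    define k where "k = 3 / 4 * (c * x) - real n * q * (3 / 4)\<^sup>2 / (2 * (1 - 3 / 4 * 1 / 3))"
    have "prob {\<omega> \<in> space M. c * x \<le> S \<omega>} \<le> exp (- k)"
      using b_range[OF n] by (intro bernstein_tail[where r = "3 / 4" and d = 1]) (auto simp: k_def)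
    also have "\<dots> \<le> exp (- (7 / 5 * x))"
    proof -
      have "k = 3 / 4 * (c * x) - 3 / 8 * (real n * q)" by (simp add: k_def power2_eq_square)
      then show ?thesis using q x False by (simp add: c_def)
    qed
    finally show ?thesis .
  qed
  define m where "m = 3 / 2 - 9 / 4 * e"
  have m: "0 < m" using e by (simp add: m_def)
  have "upper_deviation x \<subseteq> {\<omega> \<in> space M. x \<le> 1 / m * S \<omega> - (1 / m)\<^sup>2 * Q \<omega>} \<union> {\<omega> \<in> space M. c * x \<le> S \<omega>}"
  proof
    fix \<omega> assume dev: "\<omega> \<in> upper_deviation x"
    then have \<omega>: "\<omega> \<in> space M" by (simp add: upper_deviation_def)
    define s where "s = S \<omega> / x"
    note D = upper_deviationD[OF dev x n s_def e_def empirical_variance_nonneg[OF n]]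
    show "\<omega> \<in> {\<omega> \<in> space M. x \<le> 1 / m * S \<omega> - (1 / m)\<^sup>2 * Q \<omega>} \<union> {\<omega> \<in> space M. c * x \<le> S \<omega>}"
    proof (cases "c \<le> s")
      case True
      then show ?thesis using \<omega> x by (simp add: s_def field_simps)
    next
      case False
      have "e * s\<^sup>2 \<le> 7 / 10 \<and> 1 / 19 \<le> e \<or> s \<le> 73 / 20 \<and> e \<le> 1 / 19"
      proof (cases "1 / 19 \<le> e")
        case True
        have "s\<^sup>2 \<le> c\<^sup>2" using False D(1) by (intro power_mono) auto
        also have "c\<^sup>2 = 7 / (10 * e)" using True e by (simp add: c_def)
        finally show ?thesis using True e by (simp add: field_simps)
      qed (use False in \<open>auto simp: c_def\<close>)
      then have "m\<^sup>2 + (s - 3 / 2)\<^sup>2 / 2 + e * s\<^sup>2 \<le> m * s"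
        unfolding m_def using D(1) e by (intro small_variance_certificate) auto
      then have "m\<^sup>2 + Q \<omega> / x \<le> m * s" using D(2) by linarith
      \<comment> \<open>Scaling by \<open>x / m^2\<close> turns the certificate into the
        self-normalized event with \<open>r = 1 / m\<close>.\<close>
      then have "(m\<^sup>2 + Q \<omega> / x) * (x / m\<^sup>2) \<le> m * s * (x / m\<^sup>2)"
        using x by (intro mult_right_mono) auto
      moreover have "(m\<^sup>2 + Q \<omega> / x) * (x / m\<^sup>2) = x + Q \<omega> / m\<^sup>2"
        using x m by (simp add: distrib_right add_divide_distrib)
      moreover have "m * s * (x / m\<^sup>2) = S \<omega> / m"
        using x m by (simp add: s_def power2_eq_square)
      ultimately have "x + Q \<omega> / m\<^sup>2 \<le> S \<omega> / m" by simp
      then show ?thesis using \<omega> by (simp add: power_divide)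
    qed
  qed
  then have "prob (upper_deviation x) \<le> prob ({\<omega> \<in> space M. x \<le> 1 / m * S \<omega> - (1 / m)\<^sup>2 * Q \<omega>} \<union> {\<omega> \<in> space M. c * x \<le> S \<omega>})"
    by (intro finite_measure_mono) auto
  also have "\<dots> \<le> prob {\<omega> \<in> space M. x \<le> 1 / m * S \<omega> - (1 / m)\<^sup>2 * Q \<omega>} + prob {\<omega> \<in> space M. c * x \<le> S \<omega>}"
    by (intro measure_Un_le) auto
  also have "\<dots> \<le> exp (- x) + exp (- (7 / 5 * x))"
  proof (intro add_mono tail self_normalized_tail)
    show "1 / m * b \<le> 2 / 3"
    proof -
      have "b \<le> 2 / 3 * m" using True by (simp add: m_def e_def)
      then show ?thesis using m by (simp add: pos_divide_le_eq)
    qed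
  qed (use m in auto)
  finally show ?thesis .
qed

text \<open>The event that \<open>Q\<close> is small is split off because upper and lower deviations
  share it: both sides together then cost three exponentials instead of four. Off this event the
  certificate forces \<open>S\<close> beyond Bernstein's threshold.\<close>

lemma upper_deviation_large_variance:
  assumes n: "0 < n" and x: "0 < x" and q: "7 / 2 * x \<le> real n * q"
  defines "z \<equiv> sqrt (2 * real n * q / x)"
  shows "prob (upper_deviation x - {\<omega> \<in> space M. Q \<omega> \<le> x * (z - 11 / 10 * (1 - q))\<^sup>2 / 2}) \<le> exp (- x)"
    and "prob {\<omega> \<in> space M. Q \<omega> \<le> x * (z - 11 / 10 * (1 - q))\<^sup>2 / 2} \<le> exp (- x)"
proof -
  have q0: "0 \<le> q" and q4: "q \<le> 1 / 4" using variance_le[OF n] b_range[OF n] by auto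
  define d where "d = 1 - q"
  have d: "0 < d" "d \<le> 1" "b \<le> d" "1 - b \<le> d" using q4 q0 b_range[OF n] by (auto simp: d_def)
  have z2: "z\<^sup>2 = 2 * real n * q / x" using q0 x by (simp add: z_def)
  have z7: "7 \<le> z\<^sup>2" unfolding z2 using q x by (simp add: field_simps)
  have nq: "real n * q = x * z\<^sup>2 / 2" using x by (simp add: z2)
  have z_ge: "26 / 10 \<le> z"
  proof (rule power2_le_imp_le)
    show "(26 / 10)\<^sup>2 \<le> z\<^sup>2" using z7 by (simp add: power2_eq_square)
    show "0 \<le> z" using q0 x by (simp add: z_def)
  qed
  have e: "x / real n = 2 * q / z\<^sup>2"
    using z7 z_ge nq n by (simp add: field_simps)
  \<comment> \<open>Bernstein's threshold \<open>sqrt (2 n q x) + d x / 3\<close>, with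
    \<open>d = 1 - q\<close> as bound on the variables.\<close>
  define c where "c = x * (z + d / 3)"
  have "upper_deviation x - {\<omega> \<in> space M. Q \<omega> \<le> x * (z - 11 / 10 * (1 - q))\<^sup>2 / 2}
      \<subseteq> {\<omega> \<in> space M. c \<le> S \<omega>}"
  proof (rule subsetI, rule ccontr)
    fix \<omega> assume dev: "\<omega> \<in> upper_deviation x - {\<omega> \<in> space M. Q \<omega> \<le> x * (z - 11 / 10 * (1 - q))\<^sup>2 / 2}"
      and "\<omega> \<notin> {\<omega> \<in> space M. c \<le> S \<omega>}"
    then have \<omega>: "\<omega> \<in> upper_deviation x" "S \<omega> < c" "x * (z - 11 / 10 * (1 - q))\<^sup>2 / 2 < Q \<omega>"
      by (auto simp: upper_deviation_def)
    define s where "s = S \<omega> / x"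
    note D = upper_deviationD[OF \<omega>(1) x n s_def e[symmetric] empirical_variance_nonneg[OF n]]
    have "(s - 3 / 2)\<^sup>2 + 4 * q / z\<^sup>2 * s\<^sup>2 \<le> (z - 11 / 10 * (1 - q))\<^sup>2"
    proof (rule large_variance_certificate)
      show "s \<le> z + (1 - q) / 3" using \<omega>(2) x by (simp add: s_def c_def d_def field_simps)
    qed (use z7 z_ge q0 q4 D in auto)
    moreover have "(z - 11 / 10 * (1 - q))\<^sup>2 < 2 * (Q \<omega> / x)"
      using \<omega>(3) x by (simp add: field_simps)
    moreover have "2 * q / z\<^sup>2 * s\<^sup>2 = (4 * q / z\<^sup>2 * s\<^sup>2) / 2" by simp
    ultimately show False using D(2) by linarith
  qed
  then have "prob (upper_deviation x - {\<omega> \<in> space M. Q \<omega> \<le> x * (z - 11 / 10 * (1 - q))\<^sup>2 / 2})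
      \<le> prob {\<omega> \<in> space M. c \<le> S \<omega>}"
    by (intro finite_measure_mono) auto
  also have "\<dots> \<le> exp (- x)"
  proof -
    \<comment> \<open>This choice gives \<open>1 - r d / 3 = r z / 2\<close> and makes the exponent
      exactly \<open>x\<close>.\<close>
    define r where "r = 1 / (d / 3 + z / 2)"
    have r: "0 < r" "r * (d / 3 + z / 2) = 1" using d z_ge by (auto simp: r_def add_pos_pos)
    then have rd: "1 - r * d / 3 = r * z / 2" by (simp add: algebra_simps)
    have "0 < r * z" using r z_ge by auto
    show ?thesis
    proof (rule bernstein_tail[where r = r and d = d])
      show "r * d < 3" using rd \<open>0 < r * z\<close> by linarith
      have "r * c - x * z\<^sup>2 / 2 * r\<^sup>2 / (2 * (r * z / 2)) = x * (r * (d / 3 + z / 2))"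
        using r(1) z_ge by (simp add: c_def field_simps power2_eq_square)
      then show "x = r * c - real n * q * r\<^sup>2 / (2 * (1 - r * d / 3))"
        using r by (simp add: rd nq)
    qed (use r d in auto)
  qed
  finally show "prob (upper_deviation x - {\<omega> \<in> space M. Q \<omega> \<le> x * (z - 11 / 10 * (1 - q))\<^sup>2 / 2}) \<le> exp (- x)" .
  \<comment> \<open>The best \<open>\<tau>\<close> would be \<open>ln (n q / v)\<close>. Instead
    \<open>exp \<tau>\<close> is at least \<open>1 + p + 3 p^2 / 8\<close> by
    \<open>quadratic_le_exp\<close>, while \<open>n q\<close> is at least \<open>v\<close> times the
    same quadratic. The exponent before division by \<open>d^2\<close> is then at least
    \<open>v p^2 / 2\<close>, and \<open>p = 2 d / \<rho>\<close> makes this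
    \<open>x d^2\<close>.\<close>
  define \<rho> where "\<rho> = z - 11 / 10 * d"
  define p where "p = 2 * d / \<rho>"
  define \<tau> where "\<tau> = p - p\<^sup>2 / 8"
  define v where "v = x * \<rho>\<^sup>2 / 2"
  have \<rho>: "3 / 2 * d \<le> \<rho>" "0 < \<rho>" using d z_ge by (auto simp: \<rho>_def)
  have p: "0 \<le> p" "p \<le> 4 / 3" using \<rho> d by (auto simp: p_def field_simps)
  have \<tau>: "0 \<le> \<tau>"
  proof -
    have "p * p \<le> p * 8" using p by (intro mult_left_mono) auto
    then show ?thesis by (simp add: \<tau>_def power2_eq_square)
  qed
  have v: "0 \<le> v" using x by (simp add: v_def)
  have v_le: "v * (1 + p + 3 * p\<^sup>2 / 8) \<le> real n * q"
  proof -
    have "v * (1 + p + 3 * p\<^sup>2 / 8) = x / 2 * (\<rho>\<^sup>2 + 2 * d * \<rho> + 3 / 2 * d\<^sup>2)"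
      using \<rho> by (simp add: v_def p_def field_simps power2_eq_square)
    also have "\<dots> \<le> x / 2 * z\<^sup>2"
    proof (intro mult_left_mono)
      \<comment> \<open>As \<open>\<rho> + d = z - d / 10\<close>, the quadratic equals
        \<open>(z - d / 10)^2 + d^2 / 2\<close>. The surplus \<open>1/10\<close> in the constant
        \<open>11/10\<close> pays for \<open>d^2 / 2\<close>, because
        \<open>z >= 26/10\<close>.\<close>
      have "51 / 100 * (d * d) \<le> 1 / 5 * (z * d)"
      proof -
        have "d * (51 / 100 * d) \<le> d * (1 / 5 * z)" using d z_ge by (intro mult_left_mono) auto
        then show ?thesis by (simp add: ac_simps)
      qed
      then show "\<rho>\<^sup>2 + 2 * d * \<rho> + 3 / 2 * d\<^sup>2 \<le> z\<^sup>2"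
        by (simp add: \<rho>_def field_simps power2_eq_square)
    qed (use x in simp)
    also have "\<dots> = real n * q" by (simp add: nq)
    finally show ?thesis .
  qed
  have "x \<le> ((1 - exp (- \<tau>)) * (real n * q) - \<tau> * v) / d\<^sup>2"
  proof -
    have "x * d\<^sup>2 = v * (p\<^sup>2 / 2)"
      using \<rho> by (simp add: v_def p_def power_divide power_mult_distrib)
    also have "\<dots> = v * (1 + p + 3 * p\<^sup>2 / 8) - v * 1 - \<tau> * v"
      by (simp add: \<tau>_def algebra_simps)
    also have "\<dots> \<le> v * (1 + p + 3 * p\<^sup>2 / 8) - v * (exp (- \<tau>) * (1 + p + 3 * p\<^sup>2 / 8)) - \<tau> * v"
    proof -
      have "exp (- \<tau>) * (1 + p + 3 * p\<^sup>2 / 8) \<le> exp (- \<tau>) * exp \<tau>"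
        using quadratic_le_exp[OF p] by (intro mult_left_mono) (auto simp: \<tau>_def)
      then have "v * (exp (- \<tau>) * (1 + p + 3 * p\<^sup>2 / 8)) \<le> v * 1"
        using v by (intro mult_left_mono) (auto simp: exp_minus)
      then show ?thesis by linarith
    qed
    also have "\<dots> = (1 - exp (- \<tau>)) * (v * (1 + p + 3 * p\<^sup>2 / 8)) - \<tau> * v"
      by (simp add: field_simps)
    also have "\<dots> \<le> (1 - exp (- \<tau>)) * (real n * q) - \<tau> * v"
      using v_le \<tau> by (intro diff_right_mono mult_left_mono) auto
    finally show ?thesis using d by (simp add: field_simps)
  qed
  then have "exp (- (((1 - exp (- \<tau>)) * (real n * q) - \<tau> * v) / d\<^sup>2)) \<le> exp (- x)"
    by (subst exp_le_cancel_iff) linarith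
  then have "prob {\<omega> \<in> space M. Q \<omega> \<le> v} \<le> exp (- x)"
    by (rule order_trans[OF second_moment_lower_tail[OF d(1,3,4) \<tau> refl]])
  then show "prob {\<omega> \<in> space M. Q \<omega> \<le> x * (z - 11 / 10 * (1 - q))\<^sup>2 / 2} \<le> exp (- x)"
    unfolding v_def \<rho>_def d_def .
qed

text \<open>In the first two regimes each side costs at most \<open>3/2 exp (- x)\<close>. In the
  third, the two deviations off the small-\<open>Q\<close> event and that event itself cost
  \<open>exp (- x)\<close> each.\<close>

theorem empirical_bernstein:
  assumes n: "0 < n" and x: "ln 6 \<le> x"
  shows "prob {\<omega> \<in> space M. 3 / 2 * x + sqrt (2 * x * (Q \<omega> - (S \<omega>)\<^sup>2 / real n)) < \<bar>S \<omega>\<bar>} \<le> 3 * exp (- x)"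
proof -
  have x0: "0 < x" using x ln_gt_zero[of 6] by linarith
  interpret neg: centered_sample M "\<lambda>j \<omega>. - Y j \<omega>" n "1 - b" q
    by (rule centered_sample_uminus)
  let ?U = "upper_deviation x" and ?L = "neg.upper_deviation x"
  have "{\<omega> \<in> space M. 3 / 2 * x + sqrt (2 * x * (Q \<omega> - (S \<omega>)\<^sup>2 / real n)) < \<bar>S \<omega>\<bar>} = ?U \<union> ?L"
    by (auto simp: upper_deviation_def neg.upper_deviation_def sum_negf)
  moreover have "prob (?U \<union> ?L) \<le> 3 * exp (- x)"
  proof (cases "2 / 9 \<le> x / real n \<or> real n * q \<le> 7 / 2 * x")
    case True
    have half: "exp (- (7 / 5 * x)) \<le> exp (- x) / 2"
    proof -
      \<comment> \<open>From \<open>32 <= 36\<close> it follows that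
        \<open>2/5 ln 6 >= ln 2\<close>, so the extra factor \<open>exp (- 2/5 x)\<close> is at most
        one half.\<close>
      have "ln (2 ^ 5) \<le> ln (6\<^sup>2 :: real)"
        by (subst ln_le_cancel_iff) auto
      then have "5 * ln 2 \<le> 2 * ln (6 :: real)"
        by (simp only: ln_realpow of_nat_numeral)
      then have "exp (- (2 / 5 * x)) \<le> exp (- ln 2)" using x by (subst exp_le_cancel_iff) linarith
      then have "exp (- x) * exp (- (2 / 5 * x)) \<le> exp (- x) * (1 / 2)"
        by (intro mult_left_mono) (auto simp: exp_minus)
      then show ?thesis by (simp flip: exp_add)
    qed
    have "prob ?U \<le> exp (- x) + exp (- x) / 2" "prob ?L \<le> exp (- x) + exp (- x) / 2"
      using True half exp_ge_zero[of "- x"]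
        upper_deviation_few_samples[OF n x0] upper_deviation_small_variance[OF n x0]
        neg.upper_deviation_few_samples[OF n x0] neg.upper_deviation_small_variance[OF n x0]
      by linarith+
    moreover have "prob (?U \<union> ?L) \<le> prob ?U + prob ?L"
      by (intro measure_Un_le) auto
    ultimately show ?thesis by linarith
  next
    case False
    \<comment> \<open>Unchanged when \<open>Y\<close> is negated, so the same set serves both
      sides.\<close>
    define V where "V = {\<omega> \<in> space M. Q \<omega> \<le> x * (sqrt (2 * real n * q / x) - 11 / 10 * (1 - q))\<^sup>2 / 2}"
    have [measurable]: "V \<in> events" unfolding V_def by measurable
    have "prob (?U \<union> ?L) \<le> prob ((?U - V) \<union> (?L - V) \<union> V)"
      by (intro finite_measure_mono) auto
    also have "\<dots> \<le> prob (?U - V) + prob (?L - V) + prob V"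
      by (intro order_trans[OF measure_Un_le] add_mono measure_Un_le) auto
    also have "\<dots> \<le> exp (- x) + exp (- x) + exp (- x)"
    proof (intro add_mono)
      have q: "7 / 2 * x \<le> real n * q" using False by simp
      show "prob (?U - V) \<le> exp (- x)" "prob V \<le> exp (- x)"
        unfolding V_def by (rule upper_deviation_large_variance[OF n x0 q])+
      show "prob (?L - V) \<le> exp (- x)"
        using neg.upper_deviation_large_variance(1)[OF n x0 q] unfolding V_def power2_minus .
    qed
    finally show ?thesis by simp
  qed
  ultimately show ?thesis by simp
qed

end

section \<open>Trajectory laws\<close>

locale mdp_policy = mdp S A T R_max
  for S :: "'s measure" and A :: "'a measure" and T :: "'s \<times> 'a \<Rightarrow> (real \<times> 's) measure"
    and R_max :: real +
  fixes \<pi> :: "'s \<Rightarrow> 'a measure"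
  assumes policy: "\<pi> \<in> S \<rightarrow>\<^sub>M prob_algebra A"
begin

abbreviation "X \<equiv> step_space S A"
text \<open>The law of the first \<open>m\<close> steps from \<open>s\<close>. The history starts at
  \<open>\<lambda>_. undefined\<close>, the only point of the product over the empty index
  set.\<close>

abbreviation "prefix_law s m \<equiv> Ionescu_Tulcea.C (traj_kernel S A T \<pi> s) (\<lambda>_. X) 0 m (\<lambda>_. undefined)"

lemma IT: "s \<in> space S \<Longrightarrow> Ionescu_Tulcea (traj_kernel S A T \<pi> s) (\<lambda>_. X)"
  by (rule Ionescu_Tulcea_traj[OF policy])

lemma step_law_kernel [measurable]: "step_law S A T \<pi> \<in> S \<rightarrow>\<^sub>M prob_algebra X"
  by (rule step_law_measurable[OF policy])

lemma next_state_measurable [measurable]: "(\<lambda>x. snd (snd x)) \<in> X \<rightarrow>\<^sub>M S"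
  by (simp add: step_space_def)

lemma reward_measurable [measurable]: "(\<lambda>x. fst (snd x)) \<in> X \<rightarrow>\<^sub>M borel"
  by (simp add: step_space_def)

lemma state_at_measurable:
  "(\<lambda>(s, \<omega>). state_at s \<omega> m) \<in> S \<Otimes>\<^sub>M PiM {0..<m} (\<lambda>_. X) \<rightarrow>\<^sub>M S"
proof (cases m)
  case 0
  then show ?thesis by (simp add: state_at_def case_prod_unfold)
next
  case (Suc j)
  have "(\<lambda>z. snd z j) \<in> S \<Otimes>\<^sub>M PiM {0..<m} (\<lambda>_. X) \<rightarrow>\<^sub>M X"
    using Suc by (intro measurable_compose[OF measurable_snd measurable_component_singleton]) auto
  then have "(\<lambda>z. snd (snd (snd z j))) \<in> S \<Otimes>\<^sub>M PiM {0..<m} (\<lambda>_. X) \<rightarrow>\<^sub>M S"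
    by (rule measurable_compose[OF _ next_state_measurable])
  then show ?thesis using Suc by (simp add: state_at_def case_prod_unfold)
qed

text \<open>The Ionescu-Tulcea construction fixes the initial state; this recursion displays the
  dependence on \<open>s\<close>, as needed to prove measurability in \<open>s\<close> by
  induction.\<close>

lemma prefix_law_Suc:
  assumes "s \<in> space S"
  shows "prefix_law s (Suc m) = prefix_law s m \<bind>
    (\<lambda>\<omega>. distr (step_law S A T \<pi> (state_at s \<omega> m)) (PiM {0..<Suc m} (\<lambda>_. X)) (fun_upd \<omega> m))"
proof -
  interpret IT: Ionescu_Tulcea "traj_kernel S A T \<pi> s" "\<lambda>_. X" by (rule IT) fact
  have "prefix_law s (Suc m) = prefix_law s m \<bind> IT.eP (0 + m)" by (rule IT.C.simps)
  also have "IT.eP (0 + m)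
      = (\<lambda>\<omega>. distr (step_law S A T \<pi> (state_at s \<omega> m)) (PiM {0..<Suc m} (\<lambda>_. X)) (fun_upd \<omega> m))"
    by (rule ext) (simp only: IT.eP_def add_0, simp only: traj_kernel_def)
  finally show ?thesis .
qed

lemma prefix_law_measurable:
  "(\<lambda>s. prefix_law s m) \<in> S \<rightarrow>\<^sub>M prob_algebra (PiM {0..<m} (\<lambda>_. X))"
proof (induction m)
  case 0
  have "(\<lambda>s. return (PiM {0..<0::nat} (\<lambda>_. X)) (\<lambda>_. undefined)) \<in> S \<rightarrow>\<^sub>M prob_algebra (PiM {0..<0::nat} (\<lambda>_. X))"
    by (rule measurable_const) (auto simp: space_prob_algebra space_PiM intro!: prob_space_return)
  then show ?case
    by (rule measurable_cong[THEN iffD1, rotated]) (simp add: Ionescu_Tulcea.C.simps[OF IT])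
next
  case (Suc m)
  let ?P = "PiM {0..<m} (\<lambda>_. X)" and ?P' = "PiM {0..<Suc m} (\<lambda>_. X)"
  let ?e = "\<lambda>s \<omega>. distr (step_law S A T \<pi> (state_at s \<omega> m)) ?P' (fun_upd \<omega> m)"
  have "(\<lambda>(s, \<omega>). ?e s \<omega>) \<in> S \<Otimes>\<^sub>M ?P \<rightarrow>\<^sub>M prob_algebra ?P'"
    unfolding case_prod_unfold
  proof (rule measurable_distr_prob_space2)
    show "(\<lambda>z. step_law S A T \<pi> (state_at (fst z) (snd z) m)) \<in> S \<Otimes>\<^sub>M ?P \<rightarrow>\<^sub>M prob_algebra X"
      using measurable_compose[OF state_at_measurable step_law_kernel] by (simp add: case_prod_unfold)
    show "(\<lambda>(z, y). (snd z)(m := y)) \<in> (S \<Otimes>\<^sub>M ?P) \<Otimes>\<^sub>M X \<rightarrow>\<^sub>M ?P'"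
      unfolding case_prod_unfold by (rule measurable_fun_upd[where J = "{0..<m}"]) auto
  qed
  from measurable_bind_prob_space2[OF Suc.IH this]
  have "(\<lambda>s. prefix_law s m \<bind> ?e s) \<in> S \<rightarrow>\<^sub>M prob_algebra ?P'" .
  then show ?case
    by (rule measurable_cong[THEN iffD1, rotated])
      (simp only: prefix_law_Suc)
qed

lemma sets_traj_law: "s \<in> space S \<Longrightarrow> sets (traj_law S A T \<pi> s) = sets (traj_space S A)"
proof -
  assume "s \<in> space S"
  then interpret Ionescu_Tulcea "traj_kernel S A T \<pi> s" "\<lambda>_. X" by (rule IT)
  show ?thesis by (simp add: traj_law_def traj_space_def)
qed

text \<open>The total mass is read off from the marginal on the empty index set, which belongs to
  the projective family of probability measures.\<close>

lemma prob_space_traj_law: "s \<in> space S \<Longrightarrow> prob_space (traj_law S A T \<pi> s)"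
proof -
  assume "s \<in> space S"
  then interpret Ionescu_Tulcea "traj_kernel S A T \<pi> s" "\<lambda>_. X" by (rule IT)
  have "prob_space (distr PF.lim (PiM {} (\<lambda>_. X)) (\<lambda>x. restrict x {}))"
    unfolding distr_lim[OF finite.emptyI] by (rule PF.prob_space_P) auto
  then show ?thesis
    unfolding traj_law_def
    by (rule prob_space_distrD[rotated])
      (auto simp: measurable_cong_sets[OF PF.sets_lim refl] intro!: measurable_restrict)
qed

lemma emeasure_traj_law_emb:
  assumes "s \<in> space S" "J \<subseteq> {0..<m}" "E \<in> sets (PiM J (\<lambda>_. X))"
  shows "emeasure (traj_law S A T \<pi> s) (prod_emb UNIV (\<lambda>_. X) J E)
    = emeasure (prefix_law s m) (prod_emb {0..<m} (\<lambda>_. X) J E)"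
proof -
  interpret Ionescu_Tulcea "traj_kernel S A T \<pi> s" "\<lambda>_. X" by (rule IT) fact
  have "finite J" using assms(2) by (rule finite_subset) simp
  then show ?thesis
    using lim[OF _ assms(3)] emeasure_CI[OF assms(2,3)] by (simp add: traj_law_def)
qed

text \<open>Cylinders over finitely many coordinates form an intersection-stable generator, and on
  each of them the trajectory law agrees with a prefix law of bounded length. This makes rollouts a
  kernel in the initial state, so the sample law is a genuine two-stage experiment.\<close>

lemma traj_law_measurable [measurable]:
  "traj_law S A T \<pi> \<in> S \<rightarrow>\<^sub>M prob_algebra (traj_space S A)"
proof (rule measurable_prob_algebra_generated)
  show "sets (traj_space S A) = sigma_sets (\<Pi>\<^sub>E i\<in>(UNIV :: nat set). space X) (prod_algebra (UNIV :: nat set) (\<lambda>_. X))"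
    unfolding traj_space_def by (rule sets_PiM)
  show "Int_stable (prod_algebra (UNIV :: nat set) (\<lambda>_. X))" by (rule Int_stable_prod_algebra)
  show "prod_algebra (UNIV :: nat set) (\<lambda>_. X) \<subseteq> Pow (\<Pi>\<^sub>E i\<in>(UNIV :: nat set). space X)" by (rule prod_algebra_sets_into_space)
  fix E assume "E \<in> prod_algebra (UNIV :: nat set) (\<lambda>_. X)"
  then obtain J F where J: "finite J" and F: "\<And>i. i \<in> J \<Longrightarrow> F i \<in> sets X"
    and E: "E = prod_emb UNIV (\<lambda>_. X) J (Pi\<^sub>E J F)"
    by (auto elim!: prod_algebraE)
  obtain m where "\<forall>j\<in>J. j < m"
    using J finite_nat_set_iff_bounded by auto
  then have m: "J \<subseteq> {0..<m}" by auto
  have PF: "Pi\<^sub>E J F \<in> sets (PiM J (\<lambda>_. X))" using J F by (rule sets_PiM_I_finite)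
  have "(\<lambda>s. emeasure (prefix_law s m) (prod_emb {0..<m} (\<lambda>_. X) J (Pi\<^sub>E J F))) \<in> borel_measurable S"
    using measurable_prob_algebraD[OF prefix_law_measurable] measurable_prod_emb[OF m PF]
    by (rule measurable_emeasure_kernel)
  then show "(\<lambda>s. emeasure (traj_law S A T \<pi> s) E) \<in> borel_measurable S"
    by (rule measurable_cong[THEN iffD1, rotated]) (simp add: E emeasure_traj_law_emb[OF _ m PF])
qed (auto simp: sets_traj_law prob_space_traj_law)

lemma AE_step_law_reward:
  assumes s: "s \<in> space S"
  shows "AE x in step_law S A T \<pi> s. \<bar>fst (snd x)\<bar> \<le> R_max"
proof -
  have \<pi>s: "sets (\<pi> s) = sets A" using measurable_space[OF policy s] by (simp add: space_prob_algebra)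
  have K: "(\<lambda>a. T (s, a)) \<in> A \<rightarrow>\<^sub>M prob_algebra (borel \<Otimes>\<^sub>M S)"
    using kernel s by simp
  have "(\<lambda>a. distr (T (s, a)) X (\<lambda>x. (a, x))) \<in> A \<rightarrow>\<^sub>M prob_algebra X"
    by (rule measurable_distr_prob_space2[OF K]) (simp add: step_space_def)
  then have N: "(\<lambda>a. distr (T (s, a)) X (\<lambda>x. (a, x))) \<in> \<pi> s \<rightarrow>\<^sub>M subprob_algebra X"
    using measurable_prob_algebraD measurable_cong_sets[OF \<pi>s refl] by blast
  have "AE a in \<pi> s. AE x in distr (T (s, a)) X (\<lambda>x. (a, x)). \<bar>fst (snd x)\<bar> \<le> R_max"
  proof (rule AE_I2)
    fix a assume "a \<in> space (\<pi> s)"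
    then have a: "a \<in> space A" using sets_eq_imp_space_eq[OF \<pi>s] by simp
    have "sets (T (s, a)) = sets (borel \<Otimes>\<^sub>M S)"
      using measurable_space[OF K a] by (simp add: space_prob_algebra)
    then have "(\<lambda>x. (a, x)) \<in> T (s, a) \<rightarrow>\<^sub>M X"
      using a by (simp add: step_space_def cong: measurable_cong_sets)
    moreover have "AE x in T (s, a). \<bar>fst x\<bar> \<le> R_max"
      using reward_bounded[OF s a] by (simp add: case_prod_unfold)
    ultimately show "AE x in distr (T (s, a)) X (\<lambda>x. (a, x)). \<bar>fst (snd x)\<bar> \<le> R_max"
      by (subst AE_distr_iff) auto
  qed
  then show ?thesis
    unfolding step_law_def by (subst AE_bind[OF N]) auto
qed

lemma reward_at_measurable':
  assumes "k \<in> J"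
  shows "(\<lambda>\<omega>. reward_at \<omega> k) \<in> borel_measurable (PiM J (\<lambda>_. X))"
proof -
  have "(\<lambda>\<omega>. \<omega> k) \<in> PiM J (\<lambda>_. X) \<rightarrow>\<^sub>M X"
    using assms by (rule measurable_component_singleton)
  from measurable_compose[OF this reward_measurable] show ?thesis
    by (simp add: reward_at_def)
qed

lemma reward_at_measurable [measurable]: "(\<lambda>\<omega>. reward_at \<omega> k) \<in> borel_measurable (traj_space S A)"
  unfolding traj_space_def by (rule reward_at_measurable') simp

text \<open>Reward \<open>k\<close> sits at index \<open>k\<close> and is thus decided by the prefix
  of length \<open>Suc k\<close>, whose last step is drawn from a one-step law with bounded reward.
  The exceptional set is a cylinder over that prefix, so it stays null in the limit measure.\<close>

lemma AE_traj_law_reward: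
  assumes s: "s \<in> space S"
  shows "AE \<omega> in traj_law S A T \<pi> s. \<bar>reward_at \<omega> k\<bar> \<le> R_max"
proof -
  interpret IT: Ionescu_Tulcea "traj_kernel S A T \<pi> s" "\<lambda>_. X" using s by (rule IT)
  let ?P = "PiM {0..<Suc k} (\<lambda>_. X)"
  define E where "E = {\<omega> \<in> space ?P. \<not> \<bar>reward_at \<omega> k\<bar> \<le> R_max}"
  have meas: "(\<lambda>\<omega>. reward_at \<omega> k) \<in> borel_measurable ?P"
    by (rule reward_at_measurable') simp
  then have E: "E \<in> sets ?P" unfolding E_def by measurable
  have "AE \<omega> in prefix_law s (Suc k). \<bar>reward_at \<omega> k\<bar> \<le> R_max"
  proof -
    have C: "sets (prefix_law s k) = sets (PiM {0..<k} (\<lambda>_. X))"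
      using IT.sets_C[of "\<lambda>_. undefined" 0 k] by simp
    have eP: "IT.eP k \<in> prefix_law s k \<rightarrow>\<^sub>M subprob_algebra ?P"
      using IT.measurable_eP measurable_cong_sets[OF C refl] by blast
    have "AE \<omega> in prefix_law s k. AE \<omega>' in IT.eP k \<omega>. \<bar>reward_at \<omega>' k\<bar> \<le> R_max"
    proof (rule AE_I2)
      fix \<omega> assume "\<omega> \<in> space (prefix_law s k)"
      then have \<omega>: "\<omega> \<in> space (PiM {0..<k} (\<lambda>_. X))" using sets_eq_imp_space_eq[OF C] by simp
      then have st: "state_at s \<omega> k \<in> space S"
        using measurable_space[OF state_at_measurable, of "(s, \<omega>)" k] s
        by (simp add: space_pair_measure)
      have "fun_upd \<omega> k \<in> traj_kernel S A T \<pi> s k \<omega> \<rightarrow>\<^sub>M ?P"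
        unfolding measurable_cong_sets[OF IT.sets_P[OF \<omega>] refl]
        using \<omega> by (intro measurable_fun_upd[where J = "{0..<k}"]) auto
      moreover have "AE x in traj_kernel S A T \<pi> s k \<omega>. \<bar>reward_at (fun_upd \<omega> k x) k\<bar> \<le> R_max"
        unfolding traj_kernel_def reward_at_def using AE_step_law_reward[OF st] by simp
      ultimately show "AE \<omega>' in IT.eP k \<omega>. \<bar>reward_at \<omega>' k\<bar> \<le> R_max"
        unfolding IT.eP_def using meas by (subst AE_distr_iff) auto
    qed
    then show ?thesis
      using meas unfolding IT.C.simps add_0 by (subst AE_bind[OF eP]) auto
  qed
  then have "emeasure (prefix_law s (Suc k)) E = 0"
    using E IT.sets_C[of "\<lambda>_. undefined" 0 "Suc k"] IT.space_C[of "\<lambda>_. undefined" 0 "Suc k"]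
    by (subst (asm) AE_iff_measurable[of E]) (auto simp: E_def simp del: IT.C.simps)
  then have "emeasure (traj_law S A T \<pi> s) (prod_emb UNIV (\<lambda>_. X) {0..<Suc k} E) = 0"
    using E sets.sets_into_space[OF E]
    by (simp add: emeasure_traj_law_emb[OF s order_refl E] prod_emb_id space_PiM)
  moreover have "{\<omega> \<in> space (traj_law S A T \<pi> s). \<not> \<bar>reward_at \<omega> k\<bar> \<le> R_max}
      = prod_emb UNIV (\<lambda>_. X) {0..<Suc k} E"
    using sets_eq_imp_space_eq[OF sets_traj_law[OF s]]
    by (auto simp: prod_emb_def E_def traj_space_def space_PiM reward_at_def)
  ultimately show ?thesis
    using E sets_traj_law[OF s]
    by (subst AE_iff_measurable[OF _ refl])
      (auto simp: traj_space_def intro!: measurable_prod_emb)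
qed

end

section \<open>Discounted sums, returns and truncation\<close>

lemma discounted_sum_abs_le:
  fixes r :: "nat \<Rightarrow> real"
  assumes "\<And>k. \<bar>r k\<bar> \<le> R" "0 < \<gamma>" "\<gamma> < 1"
  shows "\<bar>\<Sum>k<l. \<gamma> ^ k * r k\<bar> \<le> R * ((1 - \<gamma> ^ l) / (1 - \<gamma>))"
proof -
  have "\<bar>\<Sum>k<l. \<gamma> ^ k * r k\<bar> \<le> (\<Sum>k<l. \<gamma> ^ k * R)"
    using assms by (intro order_trans[OF sum_abs] sum_mono) (simp add: abs_mult mult_left_mono)
  also have "\<dots> = (\<Sum>k<l. \<gamma> ^ k) * R" by (simp add: sum_distrib_right)
  also have "(\<Sum>k<l. \<gamma> ^ k) = (1 - \<gamma> ^ l) / (1 - \<gamma>)"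
    using assms by (subst sum_gp_strict) simp
  finally show ?thesis by (simp add: mult.commute)
qed

lemma discounted_sums_tail_le:
  fixes r :: "nat \<Rightarrow> real"
  assumes "\<And>k. \<bar>r k\<bar> \<le> R" "0 < \<gamma>" "\<gamma> < 1"
  shows "\<bar>(\<Sum>k. \<gamma> ^ k * r k) - (\<Sum>k<l. \<gamma> ^ k * r k)\<bar> \<le> R * (\<gamma> ^ l / (1 - \<gamma>))"
proof -
  have gp: "summable (\<lambda>k. \<gamma> ^ k * R)"
    using assms by (intro summable_mult2 summable_geometric) auto
  have le: "\<bar>\<gamma> ^ k * r k\<bar> \<le> \<gamma> ^ k * R" for k
    using assms by (simp add: abs_mult mult_left_mono)
  have sm: "summable (\<lambda>k. \<gamma> ^ k * r k)"
    by (rule summable_comparison_test'[OF gp, of 0]) (use le in auto)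
  have "(\<Sum>k. \<gamma> ^ k * r k) - (\<Sum>k<l. \<gamma> ^ k * r k) = (\<Sum>k. \<gamma> ^ (k + l) * r (k + l))"
    using suminf_split_initial_segment[OF sm, of l] by simp
  also have "\<bar>\<dots>\<bar> \<le> (\<Sum>k. \<gamma> ^ (k + l) * R)"
  proof -
    have s': "summable (\<lambda>k. \<gamma> ^ (k + l) * R)" by (rule summable_ignore_initial_segment[OF gp])
    have "summable (\<lambda>k. \<bar>\<gamma> ^ (k + l) * r (k + l)\<bar>)"
      by (rule summable_comparison_test'[OF s', of 0]) (use le in auto)
    then show ?thesis
      by (intro order_trans[OF summable_rabs] suminf_le le s')
  qed
  also have "(\<Sum>k. \<gamma> ^ (k + l) * R) = R * (\<gamma> ^ l / (1 - \<gamma>))"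
  proof -
    have "(\<Sum>k. (R * \<gamma> ^ l) * \<gamma> ^ k) = (R * \<gamma> ^ l) * (1 / (1 - \<gamma>))"
      using assms by (subst suminf_mult) (auto simp: suminf_geometric)
    then show ?thesis by (simp add: power_add mult_ac)
  qed
  finally show ?thesis .
qed

context mdp_policy begin

lemma truncated_return_measurable [measurable]:
  "truncated_return \<gamma> l \<in> borel_measurable (traj_space S A)"
  unfolding truncated_return_def[abs_def] by measurable

lemma AE_truncated_return_bounded:
  assumes "s \<in> space S" "0 < \<gamma>" "\<gamma> < 1"
  shows "AE \<omega> in traj_law S A T \<pi> s. \<bar>truncated_return \<gamma> l \<omega>\<bar> \<le> R_max * ((1 - \<gamma> ^ l) / (1 - \<gamma>))"
proof -
  have "AE \<omega> in traj_law S A T \<pi> s. \<forall>k. \<bar>reward_at \<omega> k\<bar> \<le> R_max"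
    unfolding AE_all_countable using AE_traj_law_reward[OF assms(1)] by simp
  then show ?thesis
    unfolding truncated_return_def by eventually_elim (intro discounted_sum_abs_le assms, auto)
qed

lemma policy_value_truncation_error:
  assumes s: "s \<in> space S" and \<gamma>: "0 < \<gamma>" "\<gamma> < 1"
  shows "\<bar>policy_value S A T \<pi> \<gamma> s - (\<integral>\<omega>. truncated_return \<gamma> l \<omega> \<partial>traj_law S A T \<pi> s)\<bar>
    \<le> R_max * (\<gamma> ^ l / (1 - \<gamma>))"
proof -
  define N where "N = traj_law S A T \<pi> s"
  interpret prob_space N unfolding N_def by (rule prob_space_traj_law[OF s])
  have [measurable_cong]: "sets N = sets (traj_space S A)" unfolding N_def by (rule sets_traj_law[OF s])
  let ?f = "\<lambda>\<omega>. \<Sum>k. \<gamma> ^ k * reward_at \<omega> k" and ?g = "truncated_return \<gamma> l"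
  let ?B = "R_max * (\<gamma> ^ l / (1 - \<gamma>))"
  have AE_all: "AE \<omega> in N. \<forall>k. \<bar>reward_at \<omega> k\<bar> \<le> R_max"
    unfolding AE_all_countable N_def using AE_traj_law_reward[OF s] by simp
  then have diff: "AE \<omega> in N. \<bar>?f \<omega> - ?g \<omega>\<bar> \<le> ?B"
    unfolding truncated_return_def by eventually_elim (intro discounted_sums_tail_le \<gamma>, auto)
  have [simp]: "integrable N ?g"
  proof (rule integrable_const_bound)
    show "AE \<omega> in N. norm (?g \<omega>) \<le> R_max * ((1 - \<gamma> ^ l) / (1 - \<gamma>))"
      unfolding N_def real_norm_def by (rule AE_truncated_return_bounded[OF s \<gamma>])
  qed measurable
  have int_diff [simp]: "integrable N (\<lambda>\<omega>. ?f \<omega> - ?g \<omega>)"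
    by (rule integrable_const_bound[where B = ?B]) (use diff in auto)
  \<comment> \<open>Integrability of the infinite return is recovered from the almost surely bounded
    tail and the bounded truncated return.\<close>
  have "integrable N (\<lambda>\<omega>. (?f \<omega> - ?g \<omega>) + ?g \<omega>)" by (rule Bochner_Integration.integrable_add) auto
  then have [simp]: "integrable N ?f" by simp
  have "\<bar>(\<integral>\<omega>. ?f \<omega> \<partial>N) - (\<integral>\<omega>. ?g \<omega> \<partial>N)\<bar> = \<bar>\<integral>\<omega>. ?f \<omega> - ?g \<omega> \<partial>N\<bar>" by simp
  also have "\<dots> \<le> (\<integral>\<omega>. \<bar>?f \<omega> - ?g \<omega>\<bar> \<partial>N)" by (rule integral_abs_bound)
  also have "\<dots> \<le> (\<integral>\<omega>. ?B \<partial>N)"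
    using diff by (intro integral_mono_AE) auto
  also have "\<dots> = ?B" by (simp add: prob_space)
  finally show ?thesis by (simp add: policy_value_def N_def)
qed

end

section \<open>Concentration over product measures\<close>

text \<open>Independence means that the joint law is the product of the marginals. Here the joint
  law is the image under the identity, and each marginal is the given factor.\<close>

lemma indep_vars_PiM_coordinates:
  assumes "\<And>i. i \<in> I \<Longrightarrow> prob_space (M i)" "I \<noteq> {}"
  shows "prob_space.indep_vars (PiM I M) M (\<lambda>i x. x i) I"
proof -
  interpret prob_space "PiM I M" using assms by (intro prob_space_PiM) auto
  show ?thesis
  proof (subst indep_vars_iff_distr_eq_PiM')
    have "distr (PiM I M) (PiM I M) (\<lambda>x. \<lambda>i\<in>I. x i) = distr (PiM I M) (PiM I M) (\<lambda>x. x)"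
      by (intro distr_cong) (auto simp: space_PiM)
    also have "\<dots> = PiM I M" by (rule distr_id2) simp
    also have "\<dots> = PiM I (\<lambda>i. distr (PiM I M) (M i) (\<lambda>x. x i))"
      using assms by (intro PiM_cong) (auto simp: distr_PiM_component)
    finally show "distr (PiM I M) (PiM I M) (\<lambda>x. \<lambda>i\<in>I. x i) = PiM I (\<lambda>i. distr (PiM I M) (M i) (\<lambda>x. x i))" .
  qed (use assms in auto)
qed

lemma integral_PiM_coordinate:
  fixes f :: "'a \<Rightarrow> real"
  assumes "\<And>i. i \<in> I \<Longrightarrow> prob_space (M i)" "j \<in> I" "f \<in> borel_measurable (M j)"
  shows "(\<integral>x. f (x j) \<partial>PiM I M) = (\<integral>x. f x \<partial>M j)"
proof -
  have "(\<integral>x. f x \<partial>M j) = (\<integral>x. f x \<partial>distr (PiM I M) (M j) (\<lambda>x. x j))"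
    using assms by (simp add: distr_PiM_component)
  also have "\<dots> = (\<integral>x. f (x j) \<partial>PiM I M)"
    using assms by (intro integral_distr) auto
  finally show ?thesis by simp
qed

text \<open>The shift formula for variances: recentring at an arbitrary \<open>c\<close>, later the
  true mean, expresses the empirical variance through the \<open>Q\<close> and \<open>S\<close> of
  the centred variables.\<close>

lemma sample_sd_square:
  assumes "0 < n"
  shows "(sample_sd n g)\<^sup>2 = (\<Sum>j<n. (g j - c)\<^sup>2) / real n - (\<Sum>j<n. g j - c)\<^sup>2 / (real n)\<^sup>2"
proof -
  define a where "a = sample_mean n g - c"
  have a: "(\<Sum>j<n. g j - c) = real n * a"
    using assms by (simp add: a_def sample_mean_def sum_subtractf field_simps)
  have "(\<Sum>j<n. (g j - sample_mean n g)\<^sup>2) = (\<Sum>j<n. (g j - c)\<^sup>2 - 2 * a * (g j - c) + a\<^sup>2)"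
    by (intro sum.cong) (auto simp: a_def power2_eq_square algebra_simps)
  also have "\<dots> = (\<Sum>j<n. (g j - c)\<^sup>2) - 2 * a * (\<Sum>j<n. g j - c) + real n * a\<^sup>2"
    by (simp add: sum.distrib sum_subtractf sum_distrib_left right_diff_distrib)
  also have "\<dots> = (\<Sum>j<n. (g j - c)\<^sup>2) - real n * a\<^sup>2"
    by (simp add: a power2_eq_square)
  finally have "(\<Sum>j<n. (g j - sample_mean n g)\<^sup>2) = (\<Sum>j<n. (g j - c)\<^sup>2) - real n * a\<^sup>2" .
  moreover have "0 \<le> (\<Sum>j<n. (g j - sample_mean n g)\<^sup>2)" by (intro sum_nonneg) auto
  ultimately show ?thesis
    using assms by (simp add: sample_sd_def a field_simps power2_eq_square)
qed

text \<open>The variables \<open>(g - \<mu>) / (2 G)\<close> have range one, and \<open>3/2\<close>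
  times the range \<open>2 G\<close> is the constant \<open>3 G\<close>.\<close>

lemma empirical_bernstein_PiM:
  fixes g :: "'b \<Rightarrow> real"
  assumes "prob_space N" and [measurable]: "g \<in> borel_measurable N"
    and bdd: "AE \<omega> in N. \<bar>g \<omega>\<bar> \<le> G" and n: "0 < n" and x: "ln 6 \<le> x"
  defines "\<mu> \<equiv> \<integral>\<omega>. g \<omega> \<partial>N"
  shows "measure (PiM {..<n} (\<lambda>_. N)) {\<tau> \<in> space (PiM {..<n} (\<lambda>_. N)).
      3 * G * (x / real n) + sample_sd n (\<lambda>j. g (\<tau> j)) * sqrt (2 * x / real n)
        < \<bar>sample_mean n (\<lambda>j. g (\<tau> j)) - \<mu>\<bar>} \<le> 3 * exp (- x)"
    (is "measure ?P ?bad \<le> _")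
proof -
  interpret N: prob_space N by fact
  interpret P: prob_space ?P using assms(1) by (intro prob_space_PiM)
  have x0: "0 < x" using x ln_gt_zero[of 6] by linarith
  have AE_P: "AE \<tau> in ?P. \<bar>g (\<tau> j)\<bar> \<le> G" if "j < n" for j
    using that bdd by (intro AE_PiM_component) (auto simp: N.prob_space_axioms)
  have int_g [simp]: "integrable N g"
    by (rule N.integrable_const_bound[where B = G]) (use bdd in auto)
  have \<mu>_bdd: "\<bar>\<mu>\<bar> \<le> G"
  proof -
    have "\<bar>\<mu>\<bar> \<le> (\<integral>\<omega>. \<bar>g \<omega>\<bar> \<partial>N)" unfolding \<mu>_def by (rule integral_abs_bound)
    also have "\<dots> \<le> (\<integral>\<omega>. G \<partial>N)" using bdd by (intro integral_mono_AE) auto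
    finally show ?thesis by (simp add: N.prob_space)
  qed
  show ?thesis
  \<comment> \<open>The rescaling divides by \<open>2 G\<close>; for \<open>G = 0\<close> all values
    and the mean vanish almost surely, so the strict deviation cannot occur.\<close>
  proof (cases "G = 0")
    case True
    then have \<mu>0: "\<mu> = 0" using \<mu>_bdd by simp
    have "AE \<tau> in ?P. \<forall>j. j < n \<longrightarrow> g (\<tau> j) = 0"
      unfolding AE_all_countable using AE_P True by (auto intro!: AE_impI)
    then have "AE \<tau> in ?P. \<tau> \<notin> ?bad"
    proof eventually_elim
      case (elim \<tau>)
      then have "sample_mean n (\<lambda>j. g (\<tau> j)) = 0" by (simp add: sample_mean_def)
      moreover have "0 \<le> sample_sd n (\<lambda>j. g (\<tau> j)) * sqrt (2 * x / real n)"
        using x0 by (auto simp: sample_sd_def intro!: mult_nonneg_nonneg divide_nonneg_nonneg sum_nonneg)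
      ultimately show ?case using \<mu>0 True by simp
    qed
    then have "measure ?P ?bad = 0"
      by (subst P.prob_eq_0) (auto simp: sample_sd_def sample_mean_def)
    then show ?thesis by simp
  next
    case False
    then have G: "0 < G" using \<mu>_bdd by linarith
    define Y where "Y = (\<lambda>j (\<tau> :: nat \<Rightarrow> 'b). (g (\<tau> j) - \<mu>) / (2 * G))"
    define q where "q = (\<integral>\<omega>. ((g \<omega> - \<mu>) / (2 * G))\<^sup>2 \<partial>N)"
    interpret centered_sample ?P Y n "(\<mu> + G) / (2 * G)" q
    proof unfold_locales
      have "P.indep_vars (\<lambda>_. N) (\<lambda>j \<tau>. \<tau> j) {..<n}"
        using n by (intro indep_vars_PiM_coordinates) (auto simp: N.prob_space_axioms)
      then show "P.indep_vars (\<lambda>_. borel) Y {..<n}"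
        unfolding Y_def by (rule P.indep_vars_compose2) auto
      fix j assume j: "j < n"
      show "AE \<tau> in ?P. - ((\<mu> + G) / (2 * G)) \<le> Y j \<tau> \<and> Y j \<tau> \<le> 1 - (\<mu> + G) / (2 * G)"
        using AE_P[OF j] by eventually_elim (use G in \<open>auto simp: Y_def field_simps\<close>)
      have "P.expectation (Y j) = (\<integral>\<omega>. (g \<omega> - \<mu>) / (2 * G) \<partial>N)"
        unfolding Y_def using j
        by (intro integral_PiM_coordinate[where f = "\<lambda>\<omega>. (g \<omega> - \<mu>) / (2 * G)"]) (auto simp: N.prob_space_axioms)
      also have "\<dots> = 0" by (simp add: N.prob_space \<mu>_def)
      finally show "P.expectation (Y j) = 0" .
      show "P.expectation (\<lambda>\<tau>. (Y j \<tau>)\<^sup>2) = q"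
        unfolding Y_def q_def using j
        by (intro integral_PiM_coordinate[where f = "\<lambda>\<omega>. ((g \<omega> - \<mu>) / (2 * G))\<^sup>2"]) (auto simp: N.prob_space_axioms)
    qed
    have "?bad \<subseteq> {\<tau> \<in> space ?P. 3 / 2 * x + sqrt (2 * x * (Q \<tau> - (S \<tau>)\<^sup>2 / real n)) < \<bar>S \<tau>\<bar>}"
    proof safe
      fix \<tau>
      define sd where "sd = sample_sd n (\<lambda>j. g (\<tau> j))"
      assume bad: "3 * G * (x / real n) + sample_sd n (\<lambda>j. g (\<tau> j)) * sqrt (2 * x / real n)
        < \<bar>sample_mean n (\<lambda>j. g (\<tau> j)) - \<mu>\<bar>"
      have S': "S \<tau> = (\<Sum>j<n. g (\<tau> j) - \<mu>) / (2 * G)" and Q: "Q \<tau> = (\<Sum>j<n. (g (\<tau> j) - \<mu>)\<^sup>2) / (2 * G)\<^sup>2"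
        by (simp_all add: Y_def power_divide flip: sum_divide_distrib)
      have "(\<Sum>j<n. g (\<tau> j) - \<mu>) = real n * (sample_mean n (\<lambda>j. g (\<tau> j)) - \<mu>)"
        using n by (simp add: sample_mean_def sum_subtractf right_diff_distrib)
      then have S: "S \<tau> = real n / (2 * G) * (sample_mean n (\<lambda>j. g (\<tau> j)) - \<mu>)"
        by (simp add: S')
      have "Q \<tau> - (S \<tau>)\<^sup>2 / real n = real n * sd\<^sup>2 / (2 * G)\<^sup>2"
        unfolding sd_def sample_sd_square[OF n, where c = \<mu>] S' Q using n G
        by (simp add: field_simps power2_eq_square)
      then have "2 * x * (Q \<tau> - (S \<tau>)\<^sup>2 / real n) = (real n * sd / (2 * G))\<^sup>2 * (2 * x / real n)"
        using n by (simp add: field_simps power2_eq_square)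
      then have "sqrt (2 * x * (Q \<tau> - (S \<tau>)\<^sup>2 / real n)) = \<bar>real n * sd / (2 * G)\<bar> * sqrt (2 * x / real n)"
        by (simp only: real_sqrt_mult real_sqrt_abs)
      also have "\<bar>real n * sd / (2 * G)\<bar> = real n / (2 * G) * sd"
        using G by (simp add: sd_def sample_sd_def sum_nonneg)
      finally have "3 / 2 * x + sqrt (2 * x * (Q \<tau> - (S \<tau>)\<^sup>2 / real n))
          = real n / (2 * G) * (3 * G * (x / real n) + sd * sqrt (2 * x / real n))"
        using n G by (simp add: field_simps)
      also have "\<dots> < real n / (2 * G) * \<bar>sample_mean n (\<lambda>j. g (\<tau> j)) - \<mu>\<bar>"
        using bad n G by (intro mult_strict_left_mono) (auto simp: sd_def)
      also have "\<dots> = \<bar>S \<tau>\<bar>" using G by (simp add: S abs_mult)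
      finally show "3 / 2 * x + sqrt (2 * x * (Q \<tau> - (S \<tau>)\<^sup>2 / real n)) < \<bar>S \<tau>\<bar>" .
    qed
    then have "measure ?P ?bad \<le> measure ?P {\<tau> \<in> space ?P. 3 / 2 * x + sqrt (2 * x * (Q \<tau> - (S \<tau>)\<^sup>2 / real n)) < \<bar>S \<tau>\<bar>}"
      by (intro P.finite_measure_mono) auto
    also have "\<dots> \<le> 3 * exp (- x)" by (rule empirical_bernstein[OF n x])
    finally show ?thesis .
  qed
qed

text \<open>Chernoff's bound with the best admissible parameter: the maximizer
  \<open>t / \<alpha>^2\<close> of \<open>c t - \<alpha>^2 c^2 / 2\<close> when it does not exceed
  \<open>\<beta>\<close>, and \<open>\<beta>\<close> otherwise. Using \<open>c\<close> and
  \<open>- c\<close> covers both signs, whence the factor 2.\<close>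

lemma sub_exponential_mean_deviation:
  assumes "prob_space d" and sub: "sub_exponential d X \<alpha> \<beta>" and pos: "0 < \<alpha>" "0 < \<beta>" "0 < m" "0 < L"
    and t: "\<alpha> * sqrt (2 * L / real m) \<le> \<alpha>\<^sup>2 * \<beta> \<Longrightarrow> t = \<alpha> * sqrt (2 * L / real m)"
      "\<alpha>\<^sup>2 * \<beta> < \<alpha> * sqrt (2 * L / real m) \<Longrightarrow> t = 2 * L / (\<beta> * real m)"
  shows "measure (PiM {..<m} (\<lambda>_. d)) {s \<in> space (PiM {..<m} (\<lambda>_. d)).
      t < \<bar>(\<integral>y. X y \<partial>d) - (\<Sum>i<m. X (s i)) / real m\<bar>} \<le> 2 * exp (- L)"
    (is "measure ?P ?bad \<le> _")
proof -
  interpret d: prob_space d by fact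
  interpret P: prob_space ?P using assms(1) by (intro prob_space_PiM)
  have [measurable]: "X \<in> borel_measurable d" using sub by (auto simp: sub_exponential_def)
  define \<mu> where "\<mu> = (\<integral>y. X y \<partial>d)"
  have [measurable]: "(\<lambda>s. X (s i)) \<in> borel_measurable ?P" if "i < m" for i
    using that by (intro measurable_compose[OF measurable_component_singleton]) auto
  have "P.indep_vars (\<lambda>_. d) (\<lambda>i s. s i) {..<m}"
    using pos by (intro indep_vars_PiM_coordinates) (auto simp: d.prob_space_axioms)
  then have indep: "P.indep_vars (\<lambda>_. borel) (\<lambda>i s. X (s i)) {..<m}"
    by (rule P.indep_vars_compose2) auto
  have chernoff: "measure ?P {s \<in> space ?P. real m * (\<alpha>\<^sup>2 * c\<^sup>2 / 2) + L \<le> (\<Sum>i<m. c * (X (s i) - \<mu>))} \<le> exp (- L)"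
    if c: "\<bar>c\<bar> \<le> \<beta>" for c
  proof -
    have "(\<integral>\<^sup>+s. ennreal (exp (c * (X (s i) - \<mu>))) \<partial>?P) \<le> ennreal (exp (\<alpha>\<^sup>2 * c\<^sup>2 / 2))"
      if i: "i \<in> {..<m}" for i
    proof -
      have "(\<integral>\<^sup>+s. ennreal (exp (c * (X (s i) - \<mu>))) \<partial>?P)
          = (\<integral>\<^sup>+y. ennreal (exp (c * (X y - \<mu>))) \<partial>distr ?P d (\<lambda>s. s i))"
        using i by (subst nn_integral_distr) auto
      also have "distr ?P d (\<lambda>s. s i) = d"
        using i by (intro distr_PiM_component) (auto simp: d.prob_space_axioms)
      also have "(\<integral>\<^sup>+y. ennreal (exp (c * (X y - \<mu>))) \<partial>d) = ennreal (\<integral>y. exp (c * (X y - \<mu>)) \<partial>d)"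
        using sub c by (intro nn_integral_eq_integral) (auto simp: sub_exponential_def \<mu>_def)
      also have "\<dots> \<le> ennreal (exp (\<alpha>\<^sup>2 * c\<^sup>2 / 2))"
        using sub c by (intro ennreal_leI) (auto simp: sub_exponential_def \<mu>_def)
      finally show ?thesis .
    qed
    from P.chernoff_indep_vars[where \<phi> = "\<lambda>y. c * (y - \<mu>)" and c = L, OF _ indep _ this] show ?thesis by simp
  qed
  obtain c where c: "0 < c" "c \<le> \<beta>" "real m * (\<alpha>\<^sup>2 * c\<^sup>2 / 2) + L \<le> c * (real m * t)"
  proof (cases "\<alpha> * sqrt (2 * L / real m) \<le> \<alpha>\<^sup>2 * \<beta>")
    case True
    then have t1: "t = \<alpha> * sqrt (2 * L / real m)" by (rule t)
    have t0: "0 < t" using pos by (simp add: t1)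
    have t2: "t\<^sup>2 = \<alpha>\<^sup>2 * (2 * L / real m)" using pos by (simp add: t1 power_mult_distrib)
    show ?thesis
    proof
      show "0 < t / \<alpha>\<^sup>2" using t0 pos by simp
      show "t / \<alpha>\<^sup>2 \<le> \<beta>" using True pos by (simp add: t1 pos_divide_le_eq mult.commute)
      have "real m * (\<alpha>\<^sup>2 * (t / \<alpha>\<^sup>2)\<^sup>2 / 2) = real m * t\<^sup>2 / (2 * \<alpha>\<^sup>2)"
        using pos by (simp add: power2_eq_square)
      also have "\<dots> = L" using pos by (simp add: t2)
      finally have 1: "real m * (\<alpha>\<^sup>2 * (t / \<alpha>\<^sup>2)\<^sup>2 / 2) = L" .
      have "t / \<alpha>\<^sup>2 * (real m * t) = real m * t\<^sup>2 / \<alpha>\<^sup>2" by (simp add: power2_eq_square)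
      also have "\<dots> = 2 * L" using pos by (simp add: t2)
      finally show "real m * (\<alpha>\<^sup>2 * (t / \<alpha>\<^sup>2)\<^sup>2 / 2) + L \<le> t / \<alpha>\<^sup>2 * (real m * t)" using 1 by simp
    qed
  next
    case False
    then have t1: "t = 2 * L / (\<beta> * real m)" using t(2) by simp
    show ?thesis
    proof
      \<comment> \<open>With \<open>c = \<beta>\<close> the required inequality reads
        \<open>m \<alpha>^2 \<beta>^2 / 2 + L <= 2 L\<close>. Being in the second case means
        precisely that the first summand is below \<open>L\<close>.\<close>
      have "(\<alpha>\<^sup>2 * \<beta>)\<^sup>2 \<le> (\<alpha> * sqrt (2 * L / real m))\<^sup>2"
        using False pos by (intro power_mono) auto
      then have "\<alpha>\<^sup>2 * (\<alpha>\<^sup>2 * \<beta>\<^sup>2) \<le> \<alpha>\<^sup>2 * (2 * L / real m)"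
        using pos by (simp add: power_mult_distrib power2_eq_square mult_ac)
      then have "\<alpha>\<^sup>2 * \<beta>\<^sup>2 \<le> 2 * L / real m" using pos by (simp only: mult_le_cancel_left_pos zero_less_power)
      then have "real m * (\<alpha>\<^sup>2 * \<beta>\<^sup>2) \<le> real m * (2 * L / real m)" by (intro mult_left_mono) auto
      then show "real m * (\<alpha>\<^sup>2 * \<beta>\<^sup>2 / 2) + L \<le> \<beta> * (real m * t)"
        using pos by (simp add: t1)
    qed (use pos in auto)
  qed
  have sum_eq: "(\<Sum>i<m. b * (X (s i) - \<mu>)) = b * (real m * ((\<Sum>i<m. X (s i)) / real m - \<mu>))" for b s
    using pos by (simp add: sum_subtractf right_diff_distrib flip: sum_distrib_left)
  let ?E = "\<lambda>b. {s \<in> space ?P. real m * (\<alpha>\<^sup>2 * b\<^sup>2 / 2) + L \<le> (\<Sum>i<m. b * (X (s i) - \<mu>))}"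
  have "?bad \<subseteq> ?E c \<union> ?E (- c)"
  proof
    fix s assume s: "s \<in> ?bad"
    define a where "a = (\<Sum>i<m. X (s i)) / real m - \<mu>"
    have "t \<le> a \<or> t \<le> - a" using s by (auto simp: a_def \<mu>_def)
    then have "c * (real m * t) \<le> c * (real m * a) \<or> c * (real m * t) \<le> - c * (real m * a)"
      using c(1) pos mult_left_mono[of t a "c * real m"] mult_left_mono[of t "- a" "c * real m"] by auto
    moreover have S: "(\<Sum>i<m. b * (X (s i) - \<mu>)) = b * (real m * a)" for b
      by (simp only: sum_eq a_def)
    ultimately show "s \<in> ?E c \<union> ?E (- c)"
      using s c(3) S[of c] S[of "- c"] by auto
  qed
  then have "measure ?P ?bad \<le> measure ?P (?E c \<union> ?E (- c))"
    by (intro P.finite_measure_mono) auto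
  also have "\<dots> \<le> measure ?P (?E c) + measure ?P (?E (- c))"
    by (intro measure_Un_le) auto
  also have "\<dots> \<le> exp (- L) + exp (- L)"
    using c by (intro add_mono chernoff) auto
  finally show ?thesis by simp
qed

text \<open>On a box the product measure is a finite product of measurable functions of the
  parameter, and boxes form an intersection-stable generator.\<close>

lemma PiM_kernel_measurable:
  assumes I: "finite I" and K: "\<And>i. i \<in> I \<Longrightarrow> K i \<in> M \<rightarrow>\<^sub>M prob_algebra N"
  shows "(\<lambda>s. PiM I (\<lambda>i. K i s)) \<in> M \<rightarrow>\<^sub>M prob_algebra (PiM I (\<lambda>_. N))"
proof (rule measurable_prob_algebra_generated)
  have prob: "prob_space (K i s)" and sets: "sets (K i s) = sets N" if "i \<in> I" "s \<in> space M" for i s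
    using measurable_space[OF K] that by (auto simp: space_prob_algebra)
  show "sets (PiM I (\<lambda>_. N)) = sigma_sets (\<Pi>\<^sub>E i\<in>I. space N) (prod_algebra I (\<lambda>_. N))"
    by (rule sets_PiM)
  show "Int_stable (prod_algebra I (\<lambda>_. N))" by (rule Int_stable_prod_algebra)
  show "prod_algebra I (\<lambda>_. N) \<subseteq> Pow (\<Pi>\<^sub>E i\<in>I. space N)" by (rule prod_algebra_sets_into_space)
  show "prob_space (PiM I (\<lambda>i. K i s))" if "s \<in> space M" for s
    by (rule prob_space_PiM) (rule prob[OF _ that])
  show "sets (PiM I (\<lambda>i. K i s)) = sets (PiM I (\<lambda>_. N))" if "s \<in> space M" for s
    by (rule sets_PiM_cong) (use sets that in auto)
  fix E assume "E \<in> prod_algebra I (\<lambda>_. N)"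
  then obtain J F where J: "finite J" "J \<subseteq> I" and F: "\<And>i. i \<in> J \<Longrightarrow> F i \<in> sets N"
    and E: "E = prod_emb I (\<lambda>_. N) J (Pi\<^sub>E J F)"
    by (auto elim!: prod_algebraE)
  have "emeasure (PiM I (\<lambda>i. K i s)) E = (\<Prod>i\<in>J. emeasure (K i s) (F i))" if s: "s \<in> space M" for s
  proof -
    have "E = prod_emb I (\<lambda>i. K i s) J (Pi\<^sub>E J F)"
      using sets_eq_imp_space_eq[OF sets[OF _ s]] by (auto simp: E prod_emb_def PiE_iff)
    then show ?thesis
      using J F s by (simp add: emeasure_PiM_emb prob sets subset_eq)
  qed
  moreover have "(\<lambda>s. \<Prod>i\<in>J. emeasure (K i s) (F i)) \<in> borel_measurable M"
    using J F by (intro borel_measurable_prod_ennreal measurable_emeasure_kernel[OF measurable_prob_algebraD[OF K]]) auto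
  ultimately show "(\<lambda>s. emeasure (PiM I (\<lambda>i. K i s)) E) \<in> borel_measurable M"
    by (simp cong: measurable_cong)
qed

text \<open>Reindexing along \<open>Pair i\<close> isolates the rollouts of one sampled state, so
  that the bound for \<open>n\<close> i.i.d. variables applies to each row.\<close>

lemma distr_PiM_row:
  assumes "\<And>i. i \<in> I \<Longrightarrow> prob_space (N i)" "i \<in> I"
  shows "distr (PiM (I \<times> J) (\<lambda>(i, j). N i)) (PiM J (\<lambda>_. N i)) (\<lambda>\<tau>. \<lambda>j\<in>J. \<tau> (i, j)) = PiM J (\<lambda>_. N i)"
  using distr_PiM_reindex[of "I \<times> J" "\<lambda>(i, j). N i" "Pair i" J] assms
  by (auto simp: inj_on_def)

section \<open>Assembling the bound\<close>

text \<open>The deterministic part: absolute values are 1-Lipschitz, so replacing the true value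
  \<open>v i\<close> by the target \<open>y i\<close> costs at most
  \<open>\<bar>v i - \<mu> i\<bar> + \<bar>y i - \<mu> i\<bar>\<close>, truncation bias plus
  sampling error.\<close>

lemma empirical_loss_error:
  fixes u v y \<mu> sd :: "nat \<Rightarrow> real"
  assumes "0 < m"
    and t: "\<bar>e - (\<Sum>i<m. \<bar>u i - v i\<bar>) / real m\<bar> \<le> t"
    and dev: "\<And>i. i < m \<Longrightarrow> \<bar>y i - \<mu> i\<bar> \<le> a + sd i * c"
    and bias: "\<And>i. i < m \<Longrightarrow> \<bar>v i - \<mu> i\<bar> \<le> b"
  shows "\<bar>e - (\<Sum>i<m. \<bar>u i - y i\<bar>) / real m\<bar> \<le> t + (a + (\<Sum>i<m. sd i) / real m * c + b)"
proof -
  have "\<bar>(\<Sum>i<m. \<bar>u i - v i\<bar>) - (\<Sum>i<m. \<bar>u i - y i\<bar>)\<bar> \<le> (\<Sum>i<m. \<bar>\<bar>u i - v i\<bar> - \<bar>u i - y i\<bar>\<bar>)"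
    by (simp add: sum_abs flip: sum_subtractf)
  also have "\<dots> \<le> (\<Sum>i<m. a + sd i * c + b)"
  proof (rule sum_mono)
    fix i assume "i \<in> {..<m}"
    then show "\<bar>\<bar>u i - v i\<bar> - \<bar>u i - y i\<bar>\<bar> \<le> a + sd i * c + b"
      using dev[of i] bias[of i] by auto
  qed
  also have "\<dots> = real m * (a + (\<Sum>i<m. sd i) / real m * c + b)"
    using assms(1) by (simp add: sum.distrib distrib_left flip: sum_distrib_right)
  finally have "\<bar>(\<Sum>i<m. \<bar>u i - v i\<bar>) - (\<Sum>i<m. \<bar>u i - y i\<bar>)\<bar> / real m
      \<le> a + (\<Sum>i<m. sd i) / real m * c + b"
    using assms(1) by (simp add: pos_divide_le_eq mult.commute)
  moreover have "\<bar>(\<Sum>i<m. \<bar>u i - v i\<bar>) - (\<Sum>i<m. \<bar>u i - y i\<bar>)\<bar> / real m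
      = \<bar>(\<Sum>i<m. \<bar>u i - v i\<bar>) / real m - (\<Sum>i<m. \<bar>u i - y i\<bar>) / real m\<bar>"
    by (simp add: abs_divide flip: diff_divide_distrib)
  ultimately show ?thesis using t by linarith
qed

theorem corollary2:
  fixes S :: "'s measure" and A :: "'a measure"
    and T :: "'s \<times> 'a \<Rightarrow> (real \<times> 's) measure" and \<pi> :: "'s \<Rightarrow> 'a measure"
    and d :: "'s measure" and v_hat :: "nat \<Rightarrow> 's \<Rightarrow> real"
    and R_max \<gamma> \<delta> \<alpha> \<beta> \<sigma>1 \<sigma>2 t :: real and m n l K :: nat
  assumes "mdp S A T R_max"
    and "\<pi> \<in> S \<rightarrow>\<^sub>M prob_algebra A"
    and "0 < \<delta>" "\<delta> < 1"
    and "0 < \<gamma>" "\<gamma> < 1"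
    and "0 < \<alpha>" "0 < \<beta>"
    and "1 \<le> m" "1 \<le> n" "1 \<le> l" "1 \<le> K"
    and "prob_space d" "sets d = sets S"
    and "\<And>k. k < K \<Longrightarrow> v_hat k \<in> borel_measurable S"
    and "\<And>k. k < K \<Longrightarrow>
      sub_exponential d (\<lambda>s. \<bar>v_hat k s - policy_value S A T \<pi> \<gamma> s\<bar>) \<alpha> \<beta>"
    and "\<sigma>1 = \<alpha> * sqrt (2 * ln (4 * real K / \<delta>) / real m)"
    and "\<sigma>2 = 2 * ln (4 * real K / \<delta>) / (\<beta> * real m)"
    and "0 < \<sigma>1 \<and> \<sigma>1 \<le> \<alpha>\<^sup>2 * \<beta> \<and> 0 < \<sigma>2 \<and> \<sigma>2 \<le> \<alpha>\<^sup>2 * \<beta> \<Longrightarrow> t = \<sigma>1"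
    and "\<sigma>1 > \<alpha>\<^sup>2 * \<beta> \<and> \<sigma>2 > \<alpha>\<^sup>2 * \<beta> \<Longrightarrow> t = \<sigma>2"
  shows "measure (sample_law S A T \<pi> d m n)
      {(s, \<tau>) \<in> space (sample_law S A T \<pi> d m n).
        let g = (\<lambda>i j. truncated_return \<gamma> l (\<tau> (i, j)));
            v_bar = (\<lambda>i. sample_mean n (g i));
            \<sigma>_bar = (\<lambda>i. sample_sd n (g i));
            \<zeta> = 3 * R_max * ((1 - \<gamma> ^ l) / (1 - \<gamma>)) * (ln (6 * real m / \<delta>) / real n)
              + (\<Sum>i<m. \<sigma>_bar i) / real m * sqrt (2 * ln (6 * real m / \<delta>) / real n)
              + R_max * (\<gamma> ^ l / (1 - \<gamma>))
        in \<forall>k<K. \<bar>loss d (v_hat k) (policy_value S A T \<pi> \<gamma>)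
                    - empirical_loss m s (v_hat k) v_bar\<bar> \<le> t + \<zeta>}
    \<ge> 1 - \<delta>"
    (is "measure ?M ?good \<ge> _")
proof -
  interpret mdp_policy S A T R_max \<pi>
    using assms(1,2) by (intro mdp_policy.intro mdp_policy_axioms.intro)
  interpret d: prob_space d by fact
  note \<delta> = assms(3,4) and \<gamma> = assms(5,6) and sets_d = assms(14)
  have m: "0 < m" and n: "0 < n" and K: "0 < K" using assms by auto
  define v where "v = policy_value S A T \<pi> \<gamma>"
  define N where "N = traj_law S A T \<pi>"
  define g where "g = (truncated_return \<gamma> l :: ('s, 'a) traj \<Rightarrow> real)"
  define \<mu> where "\<mu> s = (\<integral>\<omega>. g \<omega> \<partial>N s)" for s
  define x where "x = ln (6 * real m / \<delta>)"
  define L where "L = ln (4 * real K / \<delta>)"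
  define G where "G = R_max * ((1 - \<gamma> ^ l) / (1 - \<gamma>))"
  define B where "B = R_max * (\<gamma> ^ l / (1 - \<gamma>))"
  \<comment> \<open>\<open>m / \<delta> >= 1\<close> supplies the threshold of the empirical
    Bernstein bound. In the logarithms, \<open>6 = 3 * 2\<close> and \<open>4 = 2 * 2\<close>: the
    number of exponentials in the tail times the halving of \<open>\<delta>\<close>.\<close>
  have x6: "ln 6 \<le> x"
    unfolding x_def using \<delta> m by (subst ln_le_cancel_iff) (auto simp: field_simps)
  have exp_x: "3 * exp (- x) = \<delta> / (2 * real m)"
    using \<delta> m by (simp add: x_def exp_minus field_simps)
  have L: "0 < L" unfolding L_def using \<delta> K by (intro ln_gt_zero) (auto simp: field_simps)
  have exp_L: "2 * exp (- L) = \<delta> / (2 * real K)"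
    using \<delta> K by (simp add: L_def exp_minus field_simps)

  \<comment> \<open>The two cases for the threshold\<close>
  have \<sigma>: "\<sigma>1 = \<alpha> * sqrt (2 * L / real m)" "\<sigma>2 = 2 * L / (\<beta> * real m)"
    using assms(17,18) by (simp_all add: L_def)
  have \<sigma>_pos: "0 < \<sigma>1" "0 < \<sigma>2" using assms(7,8) L m by (simp_all add: \<sigma>)
  \<comment> \<open>\<open>\<alpha>^2 \<beta>\<close> is thus the ratio of
    \<open>\<sigma>1^2\<close> to \<open>\<sigma>2\<close>, so \<open>\<sigma>1\<close> and
    \<open>\<sigma>2\<close> lie on the same side of it and the two cases for \<open>t\<close> are
    exhaustive.\<close>
  have "\<sigma>1\<^sup>2 = \<alpha>\<^sup>2 * \<beta> * \<sigma>2"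
    using L m assms(8) by (simp add: \<sigma> power_mult_distrib)
  then have \<sigma>_iff: "\<sigma>1 \<le> \<alpha>\<^sup>2 * \<beta> \<longleftrightarrow> \<sigma>2 \<le> \<alpha>\<^sup>2 * \<beta>"
    using \<sigma>_pos assms(7,8) abs_le_square_iff[of \<sigma>1 "\<alpha>\<^sup>2 * \<beta>"]
    by (simp add: power2_eq_square[of "\<alpha>\<^sup>2 * \<beta>"])
  have t: "\<sigma>1 \<le> \<alpha>\<^sup>2 * \<beta> \<Longrightarrow> t = \<sigma>1" "\<alpha>\<^sup>2 * \<beta> < \<sigma>1 \<Longrightarrow> t = \<sigma>2"
    using assms(19,20) \<sigma>_pos \<sigma>_iff by auto

  \<comment> \<open>The sample law as states followed by a rollout kernel\<close>
  define P where "P = PiM {..<m} (\<lambda>_. d)"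
  interpret P: prob_space P unfolding P_def using assms(13) by (intro prob_space_PiM)
  have space_d: "space d = space S" by (rule sets_eq_imp_space_eq[OF sets_d])
  have in_S: "s i \<in> space S" if "s \<in> space P" "i < m" for s i
    using that space_d by (auto simp: P_def space_PiM)
  have comp: "(\<lambda>s. s i) \<in> P \<rightarrow>\<^sub>M S" if "i < m" for i
    using measurable_component_singleton[of i "{..<m}" "\<lambda>_. d"] that
    unfolding P_def measurable_cong_sets[OF refl sets_d] by simp

  define IJ where "IJ = {..<m} \<times> {..<n}"
  define R where "R s = PiM IJ (\<lambda>(i, j). N (s i))" for s
  define W where "W = PiM {..<m} (\<lambda>_. S) \<Otimes>\<^sub>M PiM IJ (\<lambda>_. traj_space S A)"
  define \<kappa> where "\<kappa> s = distr (R s) W (\<lambda>\<tau>. (s, \<tau>))" for s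
  have M_eq: "?M = P \<bind> \<kappa>"
    by (simp add: sample_law_def P_def \<kappa>_def[abs_def] R_def W_def IJ_def N_def)
  have R_kernel: "R \<in> P \<rightarrow>\<^sub>M prob_algebra (PiM IJ (\<lambda>_. traj_space S A))"
    unfolding R_def case_prod_unfold N_def
  proof (rule PiM_kernel_measurable)
    show "(\<lambda>s. traj_law S A T \<pi> (s (fst p))) \<in> P \<rightarrow>\<^sub>M prob_algebra (traj_space S A)" if "p \<in> IJ" for p
      using that by (intro measurable_compose[OF comp traj_law_measurable]) (auto simp: IJ_def)
  qed (simp add: IJ_def)
  have sets_P: "sets P = sets (PiM {..<m} (\<lambda>_. S))"
    unfolding P_def by (rule sets_PiM_cong) (use sets_d in auto)
  have pair: "(\<lambda>(s, \<tau>). (s, \<tau>)) \<in> P \<Otimes>\<^sub>M PiM IJ (\<lambda>_. traj_space S A) \<rightarrow>\<^sub>M W"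
    unfolding case_prod_unfold prod.collapse W_def
    by (intro measurable_ident_sets sets_pair_measure_cong sets_P refl)
  have \<kappa>_kernel: "\<kappa> \<in> P \<rightarrow>\<^sub>M prob_algebra W"
    unfolding \<kappa>_def[abs_def] using R_kernel pair by (rule measurable_distr_prob_space2)
  have \<kappa>_sub: "\<kappa> \<in> P \<rightarrow>\<^sub>M subprob_algebra W" by (rule measurable_prob_algebraD[OF \<kappa>_kernel])
  have sets_M: "sets ?M = sets W"
    unfolding M_eq by (rule sets_bind[OF _ P.not_empty]) (simp add: \<kappa>_def)
  have space_M: "space ?M = space W" by (rule sets_eq_imp_space_eq[OF sets_M])
  interpret M: prob_space ?M
    unfolding M_eq using measurable_space[OF \<kappa>_kernel]
    by (intro P.prob_space_bind[OF _ \<kappa>_sub]) (auto simp: space_prob_algebra)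

  \<comment> \<open>The good event and its measurability\<close>
  define row where "row \<tau> i = (\<lambda>j. g (\<tau> (i, j)))" for \<tau> :: "nat \<times> nat \<Rightarrow> ('s, 'a) traj" and i
  define ok where "ok z \<longleftrightarrow> (\<forall>k<K. \<bar>loss d (v_hat k) v
      - (\<Sum>i<m. \<bar>v_hat k (fst z i) - sample_mean n (row (snd z) i)\<bar>) / real m\<bar>
      \<le> t + (3 * G * (x / real n) + (\<Sum>i<m. sample_sd n (row (snd z) i)) / real m * sqrt (2 * x / real n) + B))"
    for z
  have good_eq: "?good = {z \<in> space W. ok z}"
    by (auto simp: space_M ok_def row_def g_def x_def G_def B_def v_def empirical_loss_def Let_def mult.assoc)
  have row_meas: "(\<lambda>z. row (snd z) i j) \<in> borel_measurable W" if "i < m" "j < n" for i j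
  proof -
    have "(\<lambda>\<tau>. \<tau> (i, j)) \<in> PiM IJ (\<lambda>_. traj_space S A) \<rightarrow>\<^sub>M traj_space S A"
      using that by (intro measurable_component_singleton) (auto simp: IJ_def)
    then have "(\<lambda>z. snd z (i, j)) \<in> W \<rightarrow>\<^sub>M traj_space S A"
      unfolding W_def by (rule measurable_compose[OF measurable_snd])
    then show ?thesis
      unfolding row_def g_def by (rule measurable_compose[OF _ truncated_return_measurable])
  qed
  have v_hat_meas: "(\<lambda>z. v_hat k (fst z i)) \<in> borel_measurable W" if "k < K" "i < m" for k i
  proof -
    have "(\<lambda>s. s i) \<in> PiM {..<m} (\<lambda>_. S) \<rightarrow>\<^sub>M S" using that by (intro measurable_component_singleton) auto
    then have "(\<lambda>z. fst z i) \<in> W \<rightarrow>\<^sub>M S" unfolding W_def by (rule measurable_compose[OF measurable_fst])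
    then show ?thesis by (rule measurable_compose[OF _ assms(15)[OF that(1)]])
  qed
  have mean_meas: "(\<lambda>z. sample_mean n (row (snd z) i)) \<in> borel_measurable W" if "i < m" for i
    unfolding sample_mean_def
    by (intro borel_measurable_divide borel_measurable_sum borel_measurable_const row_meas) (use that in auto)
  have sd_meas: "(\<lambda>z. sample_sd n (row (snd z) i)) \<in> borel_measurable W" if "i < m" for i
    unfolding sample_sd_def
    by (intro measurable_compose[OF _ borel_measurable_sqrt] borel_measurable_divide borel_measurable_sum borel_measurable_power
        borel_measurable_diff borel_measurable_const row_meas mean_meas) (use that in auto)
  have dev_meas: "(\<lambda>z. \<bar>loss d (v_hat k) v
      - (\<Sum>i<m. \<bar>v_hat k (fst z i) - sample_mean n (row (snd z) i)\<bar>) / real m\<bar>) \<in> borel_measurable W"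
    if k: "k < K" for k
  proof -
    have "(\<lambda>z. \<Sum>i<m. \<bar>v_hat k (fst z i) - sample_mean n (row (snd z) i)\<bar>) \<in> borel_measurable W"
      using v_hat_meas[OF k] mean_meas by (intro borel_measurable_sum) (auto intro: borel_measurable_diff borel_measurable_abs)
    then show ?thesis by measurable
  qed
  have "(\<lambda>z. \<Sum>i<m. sample_sd n (row (snd z) i)) \<in> borel_measurable W"
    using sd_meas by (intro borel_measurable_sum) auto
  then have bound_meas: "(\<lambda>z. t + (3 * G * (x / real n)
      + (\<Sum>i<m. sample_sd n (row (snd z) i)) / real m * sqrt (2 * x / real n) + B)) \<in> borel_measurable W"
    by measurable
  have "{z \<in> space W. \<forall>k\<in>{..<K}. \<bar>loss d (v_hat k) v
      - (\<Sum>i<m. \<bar>v_hat k (fst z i) - sample_mean n (row (snd z) i)\<bar>) / real m\<bar>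
      \<le> t + (3 * G * (x / real n) + (\<Sum>i<m. sample_sd n (row (snd z) i)) / real m * sqrt (2 * x / real n) + B)}
      \<in> sets W"
    by (rule sets.sets_Collect_countable_All', rule borel_measurable_le[OF dev_meas bound_meas]) auto
  then have good_sets: "{z \<in> space W. ok z} \<in> sets W" by (simp only: ok_def Ball_def lessThan_iff)
  define bad where "bad = {z \<in> space W. \<not> ok z}"
  have bad_sets: "bad \<in> sets W"
  proof -
    have "bad = space W - {z \<in> space W. ok z}" by (auto simp: bad_def)
    then show ?thesis using good_sets by auto
  qed

  \<comment> \<open>Concentration of the losses over the sampled states\<close>
  define X where "X k s = \<bar>v_hat k s - v s\<bar>" for k s
  \<comment> \<open>These events involve the true values and the states only, so they are bounded
    under \<open>P\<close> before any rollout is drawn.\<close>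
  define B1 where "B1 k = {s \<in> space P. t < \<bar>loss d (v_hat k) v - (\<Sum>i<m. X k (s i)) / real m\<bar>}" for k
  have B1_sets: "B1 k \<in> P.events" if "k < K" for k
  proof -
    have "X k \<in> borel_measurable d"
      using assms(16)[OF that] by (auto simp: X_def[abs_def] v_def sub_exponential_def)
    then have [measurable]: "(\<lambda>s. X k (s i)) \<in> borel_measurable P" if "i < m" for i
      using that measurable_compose[OF measurable_component_singleton] unfolding P_def by auto
    show ?thesis unfolding B1_def by measurable
  qed
  have B1_prob: "P.prob (B1 k) \<le> \<delta> / (2 * real K)" if "k < K" for k
    using sub_exponential_mean_deviation[OF assms(13) assms(16)[OF that] assms(7,8) m L, of t] t
    by (simp add: B1_def P_def X_def loss_def v_def \<sigma> exp_L)
  have "P.prob (\<Union>k<K. B1 k) \<le> (\<Sum>k<K. P.prob (B1 k))"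
    using B1_sets by (intro P.finite_measure_subadditive_finite) auto
  also have "\<dots> \<le> (\<Sum>k<K. \<delta> / (2 * real K))" by (intro sum_mono B1_prob) auto
  also have "\<dots> = \<delta> / 2" using K by simp
  finally have B1: "P.prob (\<Union>k<K. B1 k) \<le> \<delta> / 2" .

  \<comment> \<open>Rollouts conditionally on the states\<close>
  have \<kappa>_bad: "emeasure (\<kappa> s) bad \<le> indicator (\<Union>k<K. B1 k) s + ennreal (\<delta> / 2)" if s: "s \<in> space P" for s
  proof (cases "s \<in> (\<Union>k<K. B1 k)")
    case True
    interpret ks: prob_space "\<kappa> s" using measurable_space[OF \<kappa>_kernel s] by (simp add: space_prob_algebra)
    show ?thesis using True ks.measure_le_1[of bad] by (simp add: add_increasing2)
  next
    case False
    have R_space: "sets (R s) = sets (PiM IJ (\<lambda>_. traj_space S A))" "prob_space (R s)"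
      using measurable_space[OF R_kernel s] by (auto simp: space_prob_algebra)
    interpret R: prob_space "R s" by fact
    have prob_N: "prob_space (N (s i))" if "i < m" for i
      unfolding N_def by (rule prob_space_traj_law[OF in_S[OF s that]])
    have sets_N: "sets (N (s i)) = sets (traj_space S A)" if "i < m" for i
      unfolding N_def by (rule sets_traj_law[OF in_S[OF s that]])
    define D where "D i = {\<tau> \<in> space (R s). 3 * G * (x / real n) + sample_sd n (row \<tau> i) * sqrt (2 * x / real n)
        < \<bar>sample_mean n (row \<tau> i) - \<mu> (s i)\<bar>}" for i
    have D_bound: "D i \<in> R.events \<and> R.prob (D i) \<le> \<delta> / (2 * real m)" if i: "i < m" for i
    proof -
      let ?Q = "PiM {..<n} (\<lambda>_. N (s i))" and ?r = "\<lambda>\<tau>. \<lambda>j\<in>{..<n}. \<tau> (i, j)"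
      have g_meas [measurable]: "g \<in> borel_measurable (N (s i))"
        unfolding g_def measurable_cong_sets[OF sets_N[OF i] refl] by measurable
      define E where "E = {\<tau> \<in> space ?Q. 3 * G * (x / real n) + sample_sd n (\<lambda>j. g (\<tau> j)) * sqrt (2 * x / real n)
        < \<bar>sample_mean n (\<lambda>j. g (\<tau> j)) - \<mu> (s i)\<bar>}"
      have E_sets: "E \<in> sets ?Q" unfolding E_def sample_mean_def sample_sd_def by measurable
      have Q_eq: "distr (R s) ?Q ?r = ?Q"
        unfolding R_def IJ_def using distr_PiM_row[of "{..<m}" "\<lambda>i. N (s i)" i "{..<n}"] prob_N i by simp
      have r_meas: "?r \<in> R s \<rightarrow>\<^sub>M ?Q"
      proof (rule measurable_restrict)
        fix j assume "j \<in> {..<n}"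
        then have "(\<lambda>\<tau>. \<tau> (i, j)) \<in> R s \<rightarrow>\<^sub>M (case (i, j) of (i, j) \<Rightarrow> N (s i))"
          unfolding R_def using i by (intro measurable_component_singleton) (auto simp: IJ_def)
        then show "(\<lambda>\<tau>. \<tau> (i, j)) \<in> R s \<rightarrow>\<^sub>M N (s i)" by simp
      qed
      have "D i = ?r -` E \<inter> space (R s)"
        using measurable_space[OF r_meas]
        by (auto simp: D_def E_def row_def sample_mean_def sample_sd_def)
      moreover have "measure ?Q E \<le> \<delta> / (2 * real m)"
        unfolding E_def \<mu>_def exp_x[symmetric]
      proof (rule empirical_bernstein_PiM)
        show "AE \<omega> in N (s i). \<bar>g \<omega>\<bar> \<le> G"
          unfolding N_def g_def G_def by (rule AE_truncated_return_bounded[OF in_S[OF s i] \<gamma>])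
      qed (use prob_N[OF i] n x6 in auto)
      ultimately show ?thesis
        using measure_distr[OF r_meas, of E] E_sets measurable_sets[OF r_meas E_sets] by (simp add: Q_eq)
    qed
    \<comment> \<open>If the states are good and every row is close to its conditional mean, all
      \<open>K\<close> inequalities hold at once. The row events do not depend on the value
      function, so no factor \<open>K\<close> enters here.\<close>
    have "Pair s -` bad \<inter> space (R s) \<subseteq> (\<Union>i<m. D i)"
    proof (rule subsetI, rule ccontr)
      fix \<tau> assume \<tau>: "\<tau> \<in> Pair s -` bad \<inter> space (R s)" and "\<tau> \<notin> (\<Union>i<m. D i)"
      then have dev: "\<bar>sample_mean n (row \<tau> i) - \<mu> (s i)\<bar>
          \<le> 3 * G * (x / real n) + sample_sd n (row \<tau> i) * sqrt (2 * x / real n)" if "i < m" for i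
        using that by (auto simp: D_def not_less)
      have "ok (s, \<tau>)"
        unfolding ok_def fst_conv snd_conv
      proof (intro allI impI empirical_loss_error[where v = "\<lambda>i. v (s i)" and \<mu> = "\<lambda>i. \<mu> (s i)"] m dev)
        show "\<bar>loss d (v_hat k) v - (\<Sum>i<m. \<bar>v_hat k (s i) - v (s i)\<bar>) / real m\<bar> \<le> t" if "k < K" for k
          using False s that by (auto simp: B1_def X_def not_less)
        show "\<bar>v (s i) - \<mu> (s i)\<bar> \<le> B" if "i < m" for i
          unfolding v_def \<mu>_def B_def N_def g_def
          by (rule policy_value_truncation_error[OF in_S[OF s that] \<gamma>])
      qed
      then show False using \<tau> by (auto simp: bad_def)
    qed
    then have "R.prob (Pair s -` bad \<inter> space (R s)) \<le> R.prob (\<Union>i<m. D i)"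
      using D_bound by (intro R.finite_measure_mono) auto
    also have "\<dots> \<le> (\<Sum>i<m. R.prob (D i))"
      using D_bound by (intro R.finite_measure_subadditive_finite) auto
    also have "\<dots> \<le> (\<Sum>i<m. \<delta> / (2 * real m))" using D_bound by (intro sum_mono) auto
    also have "\<dots> = \<delta> / 2" using m by simp
    finally have le: "R.prob (Pair s -` bad \<inter> space (R s)) \<le> \<delta> / 2" .
    have "Pair s \<in> R s \<rightarrow>\<^sub>M W"
      unfolding measurable_cong_sets[OF R_space(1) refl] using measurable_Pair2[OF pair s] by simp
    then have "emeasure (\<kappa> s) bad = ennreal (R.prob (Pair s -` bad \<inter> space (R s)))"
      using bad_sets by (simp add: \<kappa>_def emeasure_distr R.emeasure_eq_measure)
    also have "\<dots> \<le> ennreal (\<delta> / 2)" using le by (rule ennreal_leI)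
    finally show ?thesis using False by simp
  qed
  \<comment> \<open>Averaging the conditional bound over the states adds the two halves of
    \<open>\<delta>\<close>.\<close>
  have "emeasure ?M bad = (\<integral>\<^sup>+s. emeasure (\<kappa> s) bad \<partial>P)"
    unfolding M_eq by (rule emeasure_bind[OF P.not_empty \<kappa>_sub bad_sets])
  also have "\<dots> \<le> (\<integral>\<^sup>+s. indicator (\<Union>k<K. B1 k) s + ennreal (\<delta> / 2) \<partial>P)"
    by (intro nn_integral_mono \<kappa>_bad)
  also have "\<dots> = emeasure P (\<Union>k<K. B1 k) + ennreal (\<delta> / 2)"
    using B1_sets by (subst nn_integral_add) (auto simp: P.emeasure_space_1)
  also have "\<dots> \<le> ennreal (\<delta> / 2) + ennreal (\<delta> / 2)"
    using B1 by (intro add_right_mono) (simp add: P.emeasure_eq_measure ennreal_leI)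
  also have "\<dots> = ennreal \<delta>" using \<delta> by (simp flip: ennreal_plus)
  finally have "M.prob bad \<le> \<delta>"
    using \<delta> by (simp add: M.emeasure_eq_measure)
  moreover have "bad = space ?M - {z \<in> space W. ok z}" by (auto simp: bad_def space_M)
  ultimately show ?thesis
    unfolding good_eq using good_sets sets_M by (simp add: M.prob_compl)
qed

end
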